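(* Let $\Sigma$ be a finite alphabet, let $\rho\in(0,1)$, and let $\widehat{d_\rho}$ be the extended distance on $\Sigma^*\sqcup\mathcal{M}_\tau(\Sigma^{\mathbb{N}})$ defined in the context. Then: (1) $\widehat{d_\rho}$ is a metric on $\Sigma^*\sqcup\mathcal{M}_\tau(\Sigma^{\mathbb{N}})$. (2) The restriction of $\widehat{d_\rho}$ to $\Sigma^*$ equals $d_\rho$. (3) The metric space $\bigl(\Sigma^*\sqcup\mathcal{M}_\tau(\Sigma^{\mathbb{N}}),\widehat{d_\rho}\bigr)$ is complete, and $\Sigma^*$ is dense in it. Consequently, the completion of $(\Sigma^*,d_\rho)$ is naturally identified with the disjoint union $\Sigma^*\sqcup\mathcal{M}_\tau(\Sigma^{\mathbb{N}})$ equipped with $\widehat{d_\rho}$.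
   Context: $\Sigma$ is a finite set of characters; $\Sigma^n$ is the set of strings of length $n$, $\Sigma^*=\bigsqcup_{n\ge 0}\Sigma^n$. For strings $S,W$, the multiplicity $c(S,W)$ is the number of pairs $(P_1,P_2)$ of strings with $S=P_1WP_2$. For $n\ge1$, $[S]_n\in\mathbb{R}^{\Sigma^n}$ is the vector $[S]_n(W)=c(S,W)$. For nonnegative vectors $u,v$: $\theta(u,v)=\arccos\left(\frac{u\cdot v}{\|u\|\|v\|}\right)$ if $u,v\neq0$, $\theta(u,v)=0$ if $u=v=0$, $\theta(u,v)=\pi/2$ if exactly one is $0$. On $\Sigma^*$, $d_\rho(S,T)=\sum_{n\ge1}\rho^n\theta([S]_n,[T]_n)$; this is a metric. $\Sigma^{\mathbb{N}}$ is the set of one-sided infinite sequences $x_1x_2\cdots$ with the product topology ($\Sigma$ discrete), $\tau:x_1x_2\cdots\mapsto x_2x_3\cdots$ is the left shift, and $\mathcal{M}_\tau(\Sigma^{\mathbb{N}})$ is the set of Borel probability measures $\mu$ on $\Sigma^{\mathbb{N}}$ with $\mu\circ\tau^{-1}=\mu$. For $W\in\Sigma^n$, $\mathrm{Cyl}(W)=\{x\in\Sigma^{\mathbb{N}}:x_1\cdots x_n=W\}$. For a finite string $S$ of length $L$ and $n\ge1$, define $p_n^S\in\mathbb{R}^{\Sigma^n}$ by $p_n^S(W)=\frac{c(S,W)}{L-n+1}$ if $L\ge n$ and $p_n^S(W)=0$ if $L<n$; let $u_n(S)=p_n^S/\|p_n^S\|_2$ if $p_n^S\ne0$ and $u_n(S)=0$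 otherwise. For $\mu\in\mathcal{M}_\tau(\Sigma^{\mathbb{N}})$ define $p_n^\mu(W)=\mu(\mathrm{Cyl}(W))$ and $u_n(\mu)=p_n^\mu/\|p_n^\mu\|_2$. For $X,Y\in\Sigma^*\sqcup\mathcal{M}_\tau(\Sigma^{\mathbb{N}})$ let $\theta_n(X,Y)=\arccos\langle u_n(X),u_n(Y)\rangle$ if both $u_n(X),u_n(Y)\neq0$, $\theta_n(X,Y)=0$ if both are $0$, and $\theta_n(X,Y)=\pi/2$ if exactly one is $0$. Finally $\widehat{d_\rho}(X,Y)=\sum_{n=1}^\infty\rho^n\theta_n(X,Y)$. *)

theory Defs
  imports "HOL-Probability.Probability"
begin

text \<open>
  The alphabet is a finite set \<open>A\<close>, strings are the elements of \<open>lists A\<close>.  A vector of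
  \<open>\<real>\<^sup>I\<close> for a finite set \<open>I\<close> is a function whose values outside \<open>I\<close> are ignored, with Euclidean
  norm \<open>L2_set _ I\<close>.
\<close>

definition words :: "'a set \<Rightarrow> nat \<Rightarrow> 'a list set" where
  "words A n = {W \<in> lists A. length W = n}"

definition mult :: "'a list \<Rightarrow> 'a list \<Rightarrow> nat" where
  "mult S W = card {(P1, P2). S = P1 @ W @ P2}"

definition dot :: "'i set \<Rightarrow> ('i \<Rightarrow> real) \<Rightarrow> ('i \<Rightarrow> real) \<Rightarrow> real" where
  "dot I u v = (\<Sum>i\<in>I. u i * v i)"

definition vanishes :: "'i set \<Rightarrow> ('i \<Rightarrow> real) \<Rightarrow> bool" where
  "vanishes I u \<longleftrightarrow> (\<forall>i\<in>I. u i = 0)"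

definition angle :: "'i set \<Rightarrow> ('i \<Rightarrow> real) \<Rightarrow> ('i \<Rightarrow> real) \<Rightarrow> real" where
  "angle I u v =
    (if vanishes I u \<and> vanishes I v then 0
     else if vanishes I u \<or> vanishes I v then pi / 2
     else arccos (dot I u v / (L2_set u I * L2_set v I)))"

text \<open>
  The series over \<open>n \<ge> 1\<close> is indexed by \<open>Suc n\<close>; the vector \<open>[S]\<^sub>n\<close> is \<open>\<lambda>W. mult S W\<close>
  on \<open>words A n\<close>.
\<close>

definition d_rho :: "'a set \<Rightarrow> real \<Rightarrow> 'a list \<Rightarrow> 'a list \<Rightarrow> real" where
  "d_rho A \<rho> S T =
    (\<Sum>n. \<rho> ^ Suc n *
      angle (words A (Suc n)) (\<lambda>W. real (mult S W)) (\<lambda>W. real (mult T W)))"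

text \<open>
  One-sided sequences are functions on \<open>nat\<close>, so the first letter of \<open>x\<close> is \<open>x 0\<close>.
\<close>

definition seq_topology :: "'a set \<Rightarrow> (nat \<Rightarrow> 'a) topology" where
  "seq_topology A = product_topology (\<lambda>_. discrete_topology A) UNIV"

definition seq_borel :: "'a set \<Rightarrow> (nat \<Rightarrow> 'a) measure" where
  "seq_borel A = sigma (topspace (seq_topology A)) {U. openin (seq_topology A) U}"

definition left_shift :: "(nat \<Rightarrow> 'a) \<Rightarrow> nat \<Rightarrow> 'a" where
  "left_shift x = (\<lambda>i. x (Suc i))"

text \<open>
  Only \<open>space\<close> and \<open>sets\<close> of \<open>seq_borel A\<close> matter; \<open>distr\<close> is the push-forward
  \<open>\<mu> \<circ> \<tau>\<^sup>-\<^sup>1\<close>.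
\<close>

definition shift_invariant_measures :: "'a set \<Rightarrow> (nat \<Rightarrow> 'a) measure set" where
  "shift_invariant_measures A =
    {\<mu>. sets \<mu> = sets (seq_borel A) \<and> prob_space \<mu> \<and>
        distr \<mu> (seq_borel A) left_shift = \<mu>}"

definition Cyl :: "'a set \<Rightarrow> 'a list \<Rightarrow> (nat \<Rightarrow> 'a) set" where
  "Cyl A W = {x \<in> topspace (seq_topology A). map x [0..<length W] = W}"

type_synonym 'a ext = "'a list + (nat \<Rightarrow> 'a) measure"

definition ext_space :: "'a set \<Rightarrow> 'a ext set" where
  "ext_space A = lists A <+> shift_invariant_measures A"

definition word_freq :: "'a set \<Rightarrow> nat \<Rightarrow> 'a ext \<Rightarrow> 'a list \<Rightarrow> real" where
  "word_freq A n X W =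
    (case X of
       Inl S \<Rightarrow> if n \<le> length S then real (mult S W) / real (length S - n + 1) else 0
     | Inr \<mu> \<Rightarrow> measure \<mu> (Cyl A W))"

definition unit_freq :: "'a set \<Rightarrow> nat \<Rightarrow> 'a ext \<Rightarrow> 'a list \<Rightarrow> real" where
  "unit_freq A n X W =
    (if vanishes (words A n) (word_freq A n X) then 0
     else word_freq A n X W / L2_set (word_freq A n X) (words A n))"

definition theta_ext :: "'a set \<Rightarrow> nat \<Rightarrow> 'a ext \<Rightarrow> 'a ext \<Rightarrow> real" where
  "theta_ext A n X Y =
    (let I = words A n; u = unit_freq A n X; v = unit_freq A n Y in
     if vanishes I u \<and> vanishes I v then 0
     else if vanishes I u \<or> vanishes I v then pi / 2
     else arccos (dot I u v))"

definition d_hat :: "'a set \<Rightarrow> real \<Rightarrow> 'a ext \<Rightarrow> 'a ext \<Rightarrow> real" where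
  "d_hat A \<rho> X Y = (\<Sum>n. \<rho> ^ Suc n * theta_ext A (Suc n) X Y)"

definition is_completion ::
  "'b set \<Rightarrow> ('b \<Rightarrow> 'b \<Rightarrow> real) \<Rightarrow> 'c set \<Rightarrow> ('c \<Rightarrow> 'c \<Rightarrow> real) \<Rightarrow> ('b \<Rightarrow> 'c) \<Rightarrow> bool" where
  "is_completion M d N e j \<longleftrightarrow>
    Metric_space M d \<and> Metric_space N e \<and> Metric_space.mcomplete N e \<and>
    j \<in> M \<rightarrow> N \<and> (\<forall>x\<in>M. \<forall>y\<in>M. e (j x) (j y) = d x y) \<and>
    Metric_space.mtopology N e closure_of (j ` M) = N"

end

theory Submission
  imports Defs
begin

text \<open>
  For each word length \<open>n\<close> a point of the extended space, be it a string or a shift-invariant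
  measure, has a vector of word frequencies, and \<open>\<theta>\<^sub>n\<close> is the angle between the normalised vectors,
  a vanishing vector being orthogonal to all others.  If one more coordinate records whether the
  vector vanishes, every point becomes a nonnegative unit vector and \<open>\<theta>\<^sub>n\<close> is the spherical distance,
  without any case distinction (\<open>theta_ext_eq\<close>).  The triangle inequality is the spherical one, and
  \<open>\<theta>\<^sub>n\<close> bounds each coordinate difference.  A nonzero frequency vector has entries summing to \<open>1\<close>,
  so it can be recovered from its direction; together with the set of \<open>n\<close> for which it vanishes,
  which gives the length of a string, the frequencies determine the point (\<open>ext_eqI\<close>).

  Completeness: along a Cauchy sequence all coordinates of all padded vectors converge.  If in the
  limit the vector vanishes for some \<open>n\<close>, then from some index on the sequence runs through the
  finitely many strings shorter than \<open>n\<close>.  Otherwise the frequencies of each word \<open>W\<close> converge to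
  some \<open>p W\<close>.  In a string, all but at most one occurrence of \<open>W\<close> extend to the left, and
  likewise to the right, and the string lengths tend to infinity; hence \<open>p\<close> is additive under
  extension of words on either side (\<open>stationary_limit\<close>).  Such weights are the cylinder probabilities of a shift-invariant measure
  (\<open>ex_measure_of_stationary\<close>): \<open>[0,1)\<close> is cut into nested intervals of length \<open>p W\<close>, and Lebesgue
  measure is pushed forward under the map that reads off the intervals containing a point.
  This measure is the limit.

  Density: for an invariant measure and a large \<open>L\<close>, concatenate blocks of length \<open>L\<close>, each word \<open>V\<close>
  of that length repeated about proportionally to its probability.  Occurrences inside the blocks
  have the right frequency by stationarity, and those that straddle two blocks are
  a fraction of order \<open>n / L\<close> (\<open>approximating_string\<close>).

  Finally, two completions of one metric space are identified by matching points that have the same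
  distances to all points of the original space (\<open>completion_unique\<close>).
\<close>

section \<open>Angles between nonnegative unit vectors\<close>

lemma dot_le_L2_set: "\<bar>dot I u v\<bar> \<le> L2_set u I * L2_set v I"
proof -
  have "\<bar>dot I u v\<bar> \<le> (\<Sum>i\<in>I. \<bar>u i\<bar> * \<bar>v i\<bar>)"
    unfolding dot_def by (rule order_trans[OF sum_abs]) (simp add: abs_mult)
  also have "\<dots> \<le> L2_set u I * L2_set v I" by (rule L2_set_mult_ineq)
  finally show ?thesis .
qed

definition unit_vec :: "'i set \<Rightarrow> ('i \<Rightarrow> real) \<Rightarrow> bool" where
  "unit_vec I u \<longleftrightarrow> finite I \<and> (\<forall>i\<in>I. 0 \<le> u i) \<and> dot I u u = 1"

lemma dot_commute: "dot I u v = dot I v u"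
  by (simp add: dot_def mult.commute)

lemma L2_set_unit_vec: "unit_vec I u \<Longrightarrow> L2_set u I = 1"
  by (simp add: unit_vec_def L2_set_def dot_def power2_eq_square)

lemma dot_unit_vec:
  assumes "unit_vec I u" "unit_vec I v"
  shows "0 \<le> dot I u v" "dot I u v \<le> 1"
proof -
  show "0 \<le> dot I u v" using assms by (auto simp: dot_def unit_vec_def intro!: sum_nonneg)
  show "dot I u v \<le> 1" using dot_le_L2_set[of I u v] assms by (simp add: L2_set_unit_vec)
qed

lemma arccos_nonneg_bounds:
  assumes "0 \<le> (x::real)" "x \<le> 1"
  shows "0 \<le> arccos x" "arccos x \<le> pi / 2"
  using assms arccos_lbound[of x] arccos_le_pi2[of x] by auto

text \<open>
  With \<open>\<alpha>\<close>, \<open>\<beta>\<close> the two angles on the right, it suffices that \<open>cos (\<alpha> + \<beta>) \<le> u \<bullet> w\<close>.  The components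
  of \<open>u\<close> and \<open>w\<close> orthogonal to \<open>v\<close> have norms \<open>sin \<alpha>\<close> and \<open>sin \<beta>\<close>, and their inner product is
  \<open>u \<bullet> w - cos \<alpha> cos \<beta>\<close>, so this is the Cauchy-Schwarz inequality for them.
\<close>

lemma arccos_dot_triangle:
  assumes u: "unit_vec I u" and v: "unit_vec I v" and w: "unit_vec I w"
  shows "arccos (dot I u w) \<le> arccos (dot I u v) + arccos (dot I v w)"
proof -
  define a b c where "a = dot I u v" and "b = dot I v w" and "c = dot I u w"
  have ab: "0 \<le> a" "a \<le> 1" "0 \<le> b" "b \<le> 1" "0 \<le> c" "c \<le> 1"
    unfolding a_def b_def c_def using dot_unit_vec u v w by blast+
  have uu: "dot I u u = 1" "dot I v v = 1" "dot I w w = 1" using u v w by (auto simp: unit_vec_def)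
  define u' where "u' = (\<lambda>i. u i - a * v i)"
  define w' where "w' = (\<lambda>i. w i - b * v i)"
  have dd: "dot I u' w' = c - a * b"
  proof -
    have "dot I u' w' = (\<Sum>i\<in>I. u i * w i - b * (u i * v i) - a * (v i * w i) + a * b * (v i * v i))"
      by (simp add: dot_def u'_def w'_def algebra_simps)
    also have "\<dots> = c - b * a - a * b + a * b * dot I v v"
      by (simp add: dot_def a_def b_def c_def sum.distrib sum_subtractf sum_distrib_left)
    finally show ?thesis using uu by simp
  qed
  have "dot I u' u' = (\<Sum>i\<in>I. u i * u i - 2 * a * (u i * v i) + a * a * (v i * v i))"
    by (simp add: dot_def u'_def algebra_simps)
  also have "\<dots> = dot I u u - 2 * a * a + a * a * dot I v v"
    by (simp add: dot_def a_def sum.distrib sum_subtractf sum_distrib_left)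
  finally have nu: "L2_set u' I = sqrt (1 - a\<^sup>2)"
    using uu by (simp add: L2_set_def dot_def power2_eq_square)
  have "dot I w' w' = (\<Sum>i\<in>I. w i * w i - 2 * b * (v i * w i) + b * b * (v i * v i))"
    by (simp add: dot_def w'_def algebra_simps)
  also have "\<dots> = dot I w w - 2 * b * b + b * b * dot I v v"
    by (simp add: dot_def b_def sum.distrib sum_subtractf sum_distrib_left)
  finally have nw: "L2_set w' I = sqrt (1 - b\<^sup>2)"
    using uu by (simp add: L2_set_def dot_def power2_eq_square)
  have "a * b - sqrt (1 - a\<^sup>2) * sqrt (1 - b\<^sup>2) \<le> c"
    using dot_le_L2_set[of I u' w'] dd nu nw by (simp add: abs_le_iff)
  moreover have "cos (arccos a + arccos b) = a * b - sqrt (1 - a\<^sup>2) * sqrt (1 - b\<^sup>2)"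
    using ab by (simp add: cos_add sin_arccos)
  ultimately have le: "cos (arccos a + arccos b) \<le> c" by simp
  have "arccos c \<le> arccos (cos (arccos a + arccos b))"
    using le ab by (intro arccos_le_arccos) auto
  also have "\<dots> = arccos a + arccos b"
    using arccos_nonneg_bounds ab by (intro arccos_cos) (smt (verit) field_sum_of_halves)+
  finally show ?thesis unfolding a_def b_def c_def .
qed

text \<open>
  The chord is shorter than the arc: \<open>\<parallel>u - v\<parallel>\<^sup>2 = 2 - 2 cos t \<le> t\<^sup>2\<close> for the angle \<open>t\<close>.
\<close>

lemma coordinate_diff_le_arccos_dot:
  assumes u: "unit_vec I u" and v: "unit_vec I v" and i: "i \<in> I"
  shows "\<bar>u i - v i\<bar> \<le> arccos (dot I u v)"
proof -
  define t where "t = arccos (dot I u v)"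
  have t: "0 \<le> t" "cos t = dot I u v"
    using dot_unit_vec[OF u v] by (auto simp: t_def arccos_lbound)
  have "(u i - v i)\<^sup>2 \<le> (\<Sum>i\<in>I. (u i - v i)\<^sup>2)"
    using u i by (intro member_le_sum) (auto simp: unit_vec_def)
  also have "\<dots> = dot I u u - 2 * dot I u v + dot I v v"
    by (simp add: dot_def power2_diff sum.distrib sum_subtractf sum_distrib_left power2_eq_square algebra_simps)
  also have "\<dots> = 2 - 2 * cos t" using u v t by (simp add: unit_vec_def)
  also have "\<dots> \<le> t\<^sup>2"
  proof -
    have "cos t = 1 - 2 * (sin (t/2))\<^sup>2" using cos_double_sin[of "t/2"] by simp
    moreover have "(sin (t/2))\<^sup>2 \<le> (t/2)\<^sup>2"
      using abs_sin_x_le_abs_x[of "t/2"] abs_le_square_iff by blast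
    ultimately show ?thesis by (simp add: power_divide)
  qed
  finally have "\<bar>u i - v i\<bar> \<le> \<bar>t\<bar>" by (simp add: abs_le_square_iff)
  then show ?thesis using t by (simp add: t_def)
qed

lemma arccos_dot_tendsto_0:
  assumes u: "\<And>k. unit_vec I (u k)" and v: "unit_vec I v"
    and lim: "\<And>i. i \<in> I \<Longrightarrow> (\<lambda>k. u k i) \<longlonglongrightarrow> v i"
  shows "(\<lambda>k. arccos (dot I (u k) v)) \<longlonglongrightarrow> 0"
proof -
  have "(\<lambda>k. dot I (u k) v) \<longlonglongrightarrow> dot I v v"
    unfolding dot_def by (intro tendsto_intros lim)
  then have "(\<lambda>k. dot I (u k) v) \<longlonglongrightarrow> 1" using v by (simp add: unit_vec_def)
  from continuous_on_tendsto_compose[OF continuous_on_arccos' this]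
  have "(\<lambda>k. arccos (dot I (u k) v)) \<longlonglongrightarrow> arccos 1"
    using dot_unit_vec[OF u v] by (force intro!: always_eventually intro: order_trans[of _ 0])
  then show ?thesis by simp
qed

section \<open>Uniqueness of completions\<close>

text \<open>
  The point \<open>y\<close> is the limit in the second completion of the images of a sequence in \<open>M\<close> that
  approximates \<open>x\<close> in the first; that sequence of images is Cauchy because both embeddings are
  isometric.
\<close>

lemma completion_matching_point:
  assumes N: "is_completion M d N e j" and N': "is_completion M d N' e' j'" and x: "x \<in> N"
  shows "\<exists>y\<in>N'. \<forall>s\<in>M. e' y (j' s) = e x (j s)"
proof -
  interpret N: Metric_space N e using N by (simp add: is_completion_def)
  interpret N': Metric_space N' e' using N' by (simp add: is_completion_def)
  have j: "\<And>s. s \<in> M \<Longrightarrow> j s \<in> N" "\<And>s t. s \<in> M \<Longrightarrow> t \<in> M \<Longrightarrow> e (j s) (j t) = d s t"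
    and j': "\<And>s. s \<in> M \<Longrightarrow> j' s \<in> N'" "\<And>s t. s \<in> M \<Longrightarrow> t \<in> M \<Longrightarrow> e' (j' s) (j' t) = d s t"
    using N N' by (auto simp: is_completion_def)
  have "x \<in> N.mtopology closure_of (j ` M)" using N x by (simp add: is_completion_def)
  then have "\<exists>s\<in>M. e x (j s) < inverse (Suc k)" for k :: nat
    unfolding N.metric_closure_of by (simp add: N.mball_def) (metis of_nat_0_less_iff of_nat_Suc zero_less_Suc inverse_positive_iff_positive)
  then obtain s where s: "\<And>k. s k \<in> M" "\<And>k. e x (j (s k)) < inverse (Suc k)" by metis
  have lims: "(\<lambda>k. e x (j (s k))) \<longlonglongrightarrow> 0"
    by (rule tendsto_sandwich[OF _ _ tendsto_const LIMSEQ_inverse_real_of_nat])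
       (use s(2) in \<open>auto intro!: always_eventually less_imp_le simp del: of_nat_Suc\<close>)
  have "N'.MCauchy (\<lambda>k. j' (s k))"
    unfolding N'.MCauchy_def
  proof (intro conjI allI impI)
    fix \<epsilon> :: real assume "0 < \<epsilon>"
    then obtain n0 where n0: "\<And>k. k \<ge> n0 \<Longrightarrow> e x (j (s k)) < \<epsilon> / 2"
      using order_tendstoD(2)[OF lims, of "\<epsilon>/2"] by (auto simp: eventually_sequentially)
    have "e' (j' (s k)) (j' (s l)) < \<epsilon>" if "k \<ge> n0" "l \<ge> n0" for k l
    proof -
      have "e' (j' (s k)) (j' (s l)) = e (j (s k)) (j (s l))" using s j j' by simp
      also have "\<dots> \<le> e x (j (s k)) + e x (j (s l))"
        using N.triangle[of "j (s k)" x "j (s l)"] N.commute[of "j (s k)" x] s j x by auto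
      finally show ?thesis using n0[OF that(1)] n0[OF that(2)] by simp
    qed
    then show "\<exists>n0. \<forall>k l. n0 \<le> k \<longrightarrow> n0 \<le> l \<longrightarrow> e' (j' (s k)) (j' (s l)) < \<epsilon>" by blast
  qed (use s j' in auto)
  then obtain y where y: "limitin N'.mtopology (\<lambda>k. j' (s k)) y sequentially"
    using N' by (auto simp: is_completion_def N'.mcomplete_def)
  then have yN: "y \<in> N'" and limy: "(\<lambda>k. e' (j' (s k)) y) \<longlonglongrightarrow> 0"
    using s j' by (auto simp: N'.limitin_metric_dist_null)
  have "e' y (j' t) = e x (j t)" if t: "t \<in> M" for t
  proof -
    have "(\<lambda>k. \<bar>e' y (j' t) - e x (j t)\<bar>) \<longlonglongrightarrow> 0"
    proof (rule tendsto_sandwich[OF _ _ tendsto_const])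
      show "(\<lambda>k. e' (j' (s k)) y + e x (j (s k))) \<longlonglongrightarrow> 0"
        using tendsto_add[OF limy lims] by simp
      have "\<bar>e' y (j' t) - e x (j t)\<bar> \<le> e' (j' (s k)) y + e x (j (s k))" for k
      proof -
        have "e' (j' (s k)) (j' t) = e (j (s k)) (j t)" using s j j' t by simp
        then show ?thesis
          using N'.triangle[of y "j' (s k)" "j' t"] N'.triangle[of "j' (s k)" y "j' t"]
            N.triangle[of x "j (s k)" "j t"] N.triangle[of "j (s k)" x "j t"]
            N.commute[of x "j (s k)"] N'.commute[of y "j' (s k)"] yN x j(1)[OF t] j'(1)[OF t] j(1)[OF s(1)[of k]] j'(1)[OF s(1)[of k]]
          by linarith
      qed
      then show "\<forall>\<^sub>F k in sequentially. \<bar>e' y (j' t) - e x (j t)\<bar> \<le> e' (j' (s k)) y + e x (j (s k))"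
        by simp
    qed simp
    then show ?thesis by (simp add: LIMSEQ_const_iff)
  qed
  with yN show ?thesis by blast
qed

lemma completion_distances_isometric:
  assumes N: "is_completion M d N e j" and N': "is_completion M d N' e' j'"
    and x: "x \<in> N" "x' \<in> N" and y: "y \<in> N'" "y' \<in> N'"
    and m: "\<forall>s\<in>M. e' y (j' s) = e x (j s)" "\<forall>s\<in>M. e' y' (j' s) = e x' (j s)"
  shows "e' y y' = e x x'"
proof -
  interpret N: Metric_space N e using N by (simp add: is_completion_def)
  interpret N': Metric_space N' e' using N' by (simp add: is_completion_def)
  have j: "\<And>s. s \<in> M \<Longrightarrow> j s \<in> N" and j': "\<And>s. s \<in> M \<Longrightarrow> j' s \<in> N'"
    using N N' by (auto simp: is_completion_def)
  have "\<bar>e' y y' - e x x'\<bar> \<le> 0 + \<epsilon>" if "\<epsilon> > 0" for \<epsilon>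
  proof -
    have "x' \<in> N.mtopology closure_of (j ` M)" using N x by (simp add: is_completion_def)
    then have "\<forall>r>0. \<exists>s\<in>M. e x' (j s) < r"
      unfolding N.metric_closure_of by (auto simp: N.mball_def)
    then obtain s where s: "s \<in> M" "e x' (j s) < \<epsilon> / 2"
      using \<open>\<epsilon> > 0\<close> half_gt_zero by blast
    show ?thesis
      using N.triangle[of x x' "j s"] N.triangle[of x "j s" x'] N.commute[of x' "j s"]
        N'.triangle[of y y' "j' s"] N'.triangle[of y "j' s" y'] N'.commute[of y' "j' s"]
        x y s(2) j[OF s(1)] j'[OF s(1)] m(1)[rule_format, OF s(1)] m(2)[rule_format, OF s(1)] by linarith
  qed
  then have "\<bar>e' y y' - e x x'\<bar> \<le> 0" by (rule field_le_epsilon)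
  then show ?thesis by simp
qed

text \<open>
  A point of a completion is determined by its distances to the embedded copy of \<open>M\<close>.  The relation
  of having equal such distances is therefore the graph of a bijection between the two completions,
  and every isometry over \<open>M\<close> is contained in it, which gives existence and uniqueness together.
\<close>

theorem completion_unique:
  assumes N: "is_completion M d N e j" and N': "is_completion M d N' e' j'"
  shows "\<exists>!\<phi>. \<phi> \<in> N \<rightarrow>\<^sub>E N' \<and> \<phi> ` N = N' \<and> (\<forall>x\<in>N. \<forall>y\<in>N. e' (\<phi> x) (\<phi> y) = e x y)
    \<and> (\<forall>s\<in>M. \<phi> (j s) = j' s)"
proof -
  interpret N: Metric_space N e using N by (simp add: is_completion_def)
  interpret N': Metric_space N' e' using N' by (simp add: is_completion_def)
  have j: "\<And>s. s \<in> M \<Longrightarrow> j s \<in> N" "\<And>s t. s \<in> M \<Longrightarrow> t \<in> M \<Longrightarrow> e (j s) (j t) = d s t"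
    and j': "\<And>s. s \<in> M \<Longrightarrow> j' s \<in> N'" "\<And>s t. s \<in> M \<Longrightarrow> t \<in> M \<Longrightarrow> e' (j' s) (j' t) = d s t"
    using N N' by (auto simp: is_completion_def)
  define R where "R x y \<longleftrightarrow> (\<forall>s\<in>M. e' y (j' s) = e x (j s))" for x y
  have iso: "e' y y' = e x x'" if "x \<in> N" "x' \<in> N" "y \<in> N'" "y' \<in> N'" "R x y" "R x' y'" for x x' y y'
    using completion_distances_isometric[OF N N' that(1-4)] that(5,6) by (auto simp: R_def)
  have uni: "y = y'" if "x \<in> N" "y \<in> N'" "y' \<in> N'" "R x y" "R x y'" for x y y'
    using iso[OF that(1) that(1-5)] that by simp
  obtain f where f: "\<And>x. x \<in> N \<Longrightarrow> f x \<in> N'" "\<And>x. x \<in> N \<Longrightarrow> R x (f x)"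
    using completion_matching_point[OF N N'] unfolding R_def by metis
  have Rj: "R (j s) (j' s)" if "s \<in> M" for s
    using that j j' by (simp add: R_def)
  show ?thesis
  proof (intro ex1I[of _ "restrict f N"] conjI ballI)
    show "restrict f N \<in> N \<rightarrow>\<^sub>E N'" using f by simp
    show "restrict f N ` N = N'"
    proof -
      have "y \<in> f ` N" if "y \<in> N'" for y
      proof -
        obtain x where x: "x \<in> N" "R x y"
          using completion_matching_point[OF N' N \<open>y \<in> N'\<close>] unfolding R_def by metis
        then show ?thesis using uni[OF x(1) that f(1) x(2) f(2)] by blast
      qed
      then show ?thesis using f by auto
    qed
    show "e' (restrict f N x) (restrict f N y) = e x y" if "x \<in> N" "y \<in> N" for x y
      using iso[of x y "f x" "f y"] f that by simp
    show "restrict f N (j s) = j' s" if "s \<in> M" for s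
      using uni[of "j s" "f (j s)" "j' s"] f j j' Rj that by simp
  next
    fix \<phi>
    assume \<phi>: "\<phi> \<in> N \<rightarrow>\<^sub>E N' \<and> \<phi> ` N = N' \<and> (\<forall>x\<in>N. \<forall>y\<in>N. e' (\<phi> x) (\<phi> y) = e x y)
      \<and> (\<forall>s\<in>M. \<phi> (j s) = j' s)"
    have "\<phi> x = f x" if x: "x \<in> N" for x
    proof -
      have "R x (\<phi> x)" unfolding R_def using \<phi> j x by metis
      then show ?thesis using uni[of x "\<phi> x" "f x"] \<phi> f x by auto
    qed
    then show "\<phi> = restrict f N" using \<phi> by (intro extensionalityI[of _ N]) (auto simp: PiE_def)
  qed
qed

section \<open>Counting occurrences of a word\<close>

lemma finite_words: "finite A \<Longrightarrow> finite (words A n)"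
  unfolding words_def using finite_lists_length_eq[of A n] by (simp add: lists_eq_set)

definition occurrences :: "'a list \<Rightarrow> 'a list \<Rightarrow> nat set" where
  "occurrences S W = {i. i + length W \<le> length S \<and> take (length W) (drop i S) = W}"

lemma finite_occurrences: "finite (occurrences S W)"
  by (rule finite_subset[of _ "{..length S}"]) (auto simp: occurrences_def)

lemma mult_eq_card_occurrences: "mult S W = card (occurrences S W)"
  unfolding mult_def
proof (rule bij_betw_same_card)
  show "bij_betw (\<lambda>(P1, P2). length P1) {(P1, P2). S = P1 @ W @ P2} (occurrences S W)"
  proof (rule bij_betwI[where g = "\<lambda>i. (take i S, drop (i + length W) S)"])
    show "(\<lambda>i. (take i S, drop (i + length W) S)) \<in> occurrences S W \<rightarrow> {(P1, P2). S = P1 @ W @ P2}"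
    proof (clarsimp simp: occurrences_def)
      fix i assume *: "i + length W \<le> length S" "take (length W) (drop i S) = W"
      have "S = take i S @ take (length W) (drop i S) @ drop (length W) (drop i S)"
        by (simp only: append_take_drop_id)
      moreover have "drop (length W) (drop i S) = drop (i + length W) S" by (simp add: add.commute)
      ultimately show "S = take i S @ W @ drop (i + length W) S" using * by simp
    qed
  qed (auto simp: occurrences_def)
qed

lemma mult_eq_sum:
  "real (mult S W) = (\<Sum>i<Suc (length S) - length W. of_bool (take (length W) (drop i S) = W))"
proof -
  have "occurrences S W = {i \<in> {..<Suc (length S) - length W}. take (length W) (drop i S) = W}"
    by (auto simp: occurrences_def)
  then show ?thesis
    unfolding mult_eq_card_occurrences by (simp add: of_bool_def sum.If_cases Int_def)
qed

lemma mult_le: "mult S W \<le> Suc (length S) - length W"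
proof -
  have "real (mult S W) \<le> (\<Sum>i<Suc (length S) - length W. 1)"
    unfolding mult_eq_sum by (intro sum_mono) auto
  then show ?thesis by simp
qed

lemma sum_mult_words:
  assumes "finite A" "S \<in> lists A"
  shows "(\<Sum>W\<in>words A n. real (mult S W)) = real (Suc (length S) - n)"
proof -
  have "(\<Sum>W\<in>words A n. real (mult S W))
      = (\<Sum>W\<in>words A n. \<Sum>i<Suc (length S) - n. of_bool (take n (drop i S) = W))"
    by (intro sum.cong refl) (auto simp: mult_eq_sum words_def)
  also have "\<dots> = (\<Sum>i<Suc (length S) - n. \<Sum>W\<in>words A n. of_bool (take n (drop i S) = W))"
    by (rule sum.swap)
  also have "\<dots> = (\<Sum>i<Suc (length S) - n. 1)"
  proof (intro sum.cong refl)
    fix i assume i: "i \<in> {..<Suc (length S) - n}"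
    have "take n (drop i S) \<in> words A n"
      using assms(2) i by (auto simp: words_def in_lists_conv_set dest!: in_set_takeD in_set_dropD)
    then show "(\<Sum>W\<in>words A n. of_bool (take n (drop i S) = W)) = (1::real)"
      using finite_words[OF assms(1), of n] by (simp add: of_bool_def sum.delta')
  qed
  finally show ?thesis by simp
qed

text \<open>
  Each occurrence of \<open>W\<close> other than one at the very beginning extends to the left in exactly
  one way.
\<close>

lemma sum_mult_Cons:
  assumes "finite A" "S \<in> lists A"
  shows "(\<Sum>a\<in>A. real (mult S (a # W)))
    = (\<Sum>i<length S - length W. of_bool (take (length W) (drop (Suc i) S) = W))"
proof -
  have "(\<Sum>a\<in>A. real (mult S (a # W)))
      = (\<Sum>i<length S - length W. \<Sum>a\<in>A. of_bool (take (Suc (length W)) (drop i S) = a # W))"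
    unfolding mult_eq_sum by (subst sum.swap) simp
  also have "\<dots> = (\<Sum>i<length S - length W. of_bool (take (length W) (drop (Suc i) S) = W))"
  proof (intro sum.cong refl)
    fix i assume i: "i \<in> {..<length S - length W}"
    then have "drop i S = S ! i # drop (Suc i) S" by (simp add: Cons_nth_drop_Suc)
    moreover have "S ! i \<in> A" using assms(2) i by (auto simp: in_lists_conv_set)
    ultimately show "(\<Sum>a\<in>A. of_bool (take (Suc (length W)) (drop i S) = a # W))
        = (of_bool (take (length W) (drop (Suc i) S) = W) :: real)"
      using assms(1) by (simp add: of_bool_def sum.delta' if_if_eq_conj conj_commute flip: if_bool_eq_conj)
  qed
  finally show ?thesis .
qed

lemma sum_mult_snoc:
  assumes "finite A" "S \<in> lists A"
  shows "(\<Sum>a\<in>A. real (mult S (W @ [a])))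
    = (\<Sum>i<length S - length W. of_bool (take (length W) (drop i S) = W))"
proof -
  have "(\<Sum>a\<in>A. real (mult S (W @ [a])))
      = (\<Sum>i<length S - length W. \<Sum>a\<in>A. of_bool (take (Suc (length W)) (drop i S) = W @ [a]))"
    unfolding mult_eq_sum by (subst sum.swap) simp
  also have "\<dots> = (\<Sum>i<length S - length W. of_bool (take (length W) (drop i S) = W))"
  proof (intro sum.cong refl)
    fix i assume i: "i \<in> {..<length S - length W}"
    then have "take (Suc (length W)) (drop i S) = take (length W) (drop i S) @ [S ! (i + length W)]"
      by (simp add: take_Suc_conv_app_nth)
    moreover have "S ! (i + length W) \<in> A" using assms(2) i by (auto simp: in_lists_conv_set)
    ultimately show "(\<Sum>a\<in>A. of_bool (take (Suc (length W)) (drop i S) = W @ [a]))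
        = (of_bool (take (length W) (drop i S) = W) :: real)"
      using assms(1) by (simp add: of_bool_def sum.delta' if_if_eq_conj)
  qed
  finally show ?thesis .
qed

lemma mult_minus_sum_Cons:
  assumes "finite A" "S \<in> lists A" "length W \<le> length S"
  shows "\<exists>\<delta>. 0 \<le> \<delta> \<and> \<delta> \<le> 1 \<and> real (mult S W) = (\<Sum>a\<in>A. real (mult S (a # W))) + \<delta>"
  unfolding sum_mult_Cons[OF assms(1,2)] unfolding mult_eq_sum Suc_diff_le[OF assms(3)]
  by (subst sum.lessThan_Suc_shift)
    (rule exI[of _ "of_bool (take (length W) (drop 0 S) = W)"], simp)

lemma mult_minus_sum_snoc:
  assumes "finite A" "S \<in> lists A" "length W \<le> length S"
  shows "\<exists>\<delta>. 0 \<le> \<delta> \<and> \<delta> \<le> 1 \<and> real (mult S W) = (\<Sum>a\<in>A. real (mult S (W @ [a]))) + \<delta>"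
  unfolding sum_mult_snoc[OF assms(1,2)] unfolding mult_eq_sum Suc_diff_le[OF assms(3)]
  by (rule exI[of _ "of_bool (take (length W) (drop (length S - length W) S) = W)"], simp)

text \<open>
  Besides the occurrences inside \<open>S\<close> and inside \<open>T\<close> there are only those that straddle the border,
  and these start among the last \<open>length W\<close> positions of \<open>S\<close>.
\<close>

lemma mult_append:
  assumes "W \<noteq> []"
  shows "mult S W + mult T W \<le> mult (S @ T) W"
    and "mult (S @ T) W \<le> mult S W + mult T W + length W"
proof -
  define n where "n = length W"
  have n: "n \<ge> 1" using assms by (cases W) (auto simp: n_def)
  let ?T = "(\<lambda>i. i + length S) ` occurrences T W"
  have T: "card ?T = mult T W"
    by (simp add: mult_eq_card_occurrences card_image inj_on_def)
  have sub: "occurrences S W \<union> ?T \<subseteq> occurrences (S @ T) W"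
    by (auto simp: occurrences_def)
  have "occurrences S W \<inter> ?T = {}"
    using n by (auto simp: occurrences_def n_def)
  then have "card (occurrences S W \<union> ?T) = mult S W + mult T W"
    using T by (simp add: card_Un_disjoint finite_occurrences mult_eq_card_occurrences)
  then show "mult S W + mult T W \<le> mult (S @ T) W"
    using card_mono[OF finite_occurrences sub] by (simp add: mult_eq_card_occurrences)
  have "occurrences (S @ T) W \<subseteq> occurrences S W \<union> ?T \<union> {length S - n..<length S}"
  proof
    fix i assume i: "i \<in> occurrences (S @ T) W"
    consider "i + n \<le> length S" | "i \<ge> length S" | "length S < i + n" "i < length S" by linarith
    then show "i \<in> occurrences S W \<union> ?T \<union> {length S - n..<length S}"
    proof cases
      case 2
      then have "i - length S \<in> occurrences T W" using i by (auto simp: occurrences_def)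
      then show ?thesis using 2 by (force intro: image_eqI[of _ _ "i - length S"])
    qed (use i in \<open>auto simp: occurrences_def n_def\<close>)
  qed
  from card_mono[OF _ this] have "mult (S @ T) W
      \<le> card (occurrences S W \<union> ?T \<union> {length S - n..<length S})"
    by (simp add: finite_occurrences mult_eq_card_occurrences)
  also have "\<dots> \<le> card (occurrences S W \<union> ?T) + card {length S - n..<length S}"
    by (rule card_Un_le)
  also have "\<dots> \<le> mult S W + mult T W + n"
    using card_Un_le[of "occurrences S W" ?T] T by (simp add: mult_eq_card_occurrences)
  finally show "mult (S @ T) W \<le> mult S W + mult T W + length W" by (simp add: n_def)
qed

lemma mult_Nil: "W \<noteq> [] \<Longrightarrow> mult [] W = 0"
  using mult_le[of "[]" W] by (cases W) auto

lemma mult_concat: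
  assumes "W \<noteq> []"
  shows "(\<Sum>V\<leftarrow>Vs. mult V W) \<le> mult (concat Vs) W"
    and "mult (concat Vs) W \<le> (\<Sum>V\<leftarrow>Vs. mult V W) + length W * length Vs"
proof (induction Vs)
  case (Cons V Vs)
  { case 1 then show ?case using Cons mult_append(1)[OF assms, of V "concat Vs"] by simp }
  { case 2 then show ?case using Cons mult_append(2)[OF assms, of V "concat Vs"] by simp }
qed (auto simp: mult_Nil assms)

lemma list_with_multiplicities:
  fixes m :: "'b \<Rightarrow> nat"
  assumes "finite I"
  shows "\<exists>Vs. set Vs \<subseteq> I \<and> (\<forall>f :: 'b \<Rightarrow> nat. (\<Sum>V\<leftarrow>Vs. f V) = (\<Sum>V\<in>I. m V * f V))"
  using assms
proof (induction I rule: finite_induct)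
  case (insert x I)
  then obtain Vs where Vs: "set Vs \<subseteq> I" "\<And>f :: 'b \<Rightarrow> nat. (\<Sum>V\<leftarrow>Vs. f V) = (\<Sum>V\<in>I. m V * f V)" by blast
  have "set (replicate (m x) x @ Vs) \<subseteq> insert x I" using Vs by auto
  moreover have "(\<Sum>V\<leftarrow>replicate (m x) x @ Vs. f V) = (\<Sum>V\<in>insert x I. m V * f V)" for f :: "'b \<Rightarrow> nat"
    using insert Vs by (simp add: sum_list_replicate)
  ultimately show ?case by blast
qed auto

section \<open>Stationary weights on words\<close>

lemma words_0: "words A 0 = {[]}" by (auto simp: words_def)

lemma sum_words_Suc:
  "(\<Sum>V\<in>words A (Suc n). f V) = (\<Sum>a\<in>A. \<Sum>V\<in>words A n. f (a # V))"
proof -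
  have "(\<Sum>V\<in>words A (Suc n). f V) = (\<Sum>(a, V)\<in>A \<times> words A n. f (a # V))"
    by (rule sum.reindex_bij_witness[where i = "\<lambda>(a, V). a # V" and j = "\<lambda>V. (hd V, tl V)"])
      (auto simp: words_def length_Suc_conv)
  then show ?thesis by (simp add: sum.cartesian_product)
qed

text \<open>
  On words over \<open>A\<close> these are exactly the functions \<open>W \<mapsto> \<mu> (Cyl W)\<close> of shift-invariant probability
  measures: additivity on the right makes the weights of cylinders consistent, additivity on
  the left expresses invariance under the shift.
\<close>

definition stationary :: "'a set \<Rightarrow> ('a list \<Rightarrow> real) \<Rightarrow> bool" where
  "stationary A p \<longleftrightarrow> p [] = 1 \<and> (\<forall>W\<in>lists A. 0 \<le> p W \<and>
     (\<Sum>a\<in>A. p (W @ [a])) = p W \<and> (\<Sum>a\<in>A. p (a # W)) = p W)"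

lemma sum_stationary_prefix:
  assumes "stationary A p" "W \<in> lists A"
  shows "(\<Sum>V\<in>words A n. p (V @ W)) = p W"
proof (induction n)
  case (Suc n)
  have "(\<Sum>V\<in>words A (Suc n). p (V @ W)) = (\<Sum>V\<in>words A n. \<Sum>a\<in>A. p (a # V @ W))"
    unfolding sum_words_Suc by (subst sum.swap) simp
  also have "\<dots> = (\<Sum>V\<in>words A n. p (V @ W))"
    using assms by (intro sum.cong refl) (auto simp: stationary_def words_def)
  finally show ?case using Suc by simp
qed (simp add: words_0)

lemma sum_stationary_suffix:
  assumes "stationary A p" "W \<in> lists A"
  shows "(\<Sum>V\<in>words A n. p (W @ V)) = p W"
  using assms(2)
proof (induction n arbitrary: W)
  case (Suc n)
  have "(\<Sum>V\<in>words A (Suc n). p (W @ V)) = (\<Sum>a\<in>A. \<Sum>V\<in>words A n. p ((W @ [a]) @ V))"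
    by (simp add: sum_words_Suc)
  also have "\<dots> = (\<Sum>a\<in>A. p (W @ [a]))" using Suc by (intro sum.cong refl Suc.IH) auto
  finally show ?case using assms Suc by (simp add: stationary_def)
qed (simp add: words_0)

lemma sum_stationary_words: "stationary A p \<Longrightarrow> (\<Sum>V\<in>words A n. p V) = 1"
  using sum_stationary_suffix[of A p "[]" n] by (simp add: stationary_def)

text \<open>
  The words of length \<open>L\<close> that carry \<open>W\<close> at position \<open>i\<close> are the words \<open>X @ W @ Y\<close>, and the weights are
  summed over \<open>X\<close> by left additivity and over \<open>Y\<close> by right additivity.
\<close>

lemma sum_stationary_window:
  assumes p: "stationary A p" and W: "W \<in> lists A" and i: "i + length W \<le> L" and A: "finite A"
  shows "(\<Sum>V\<in>words A L. p V * of_bool (take (length W) (drop i V) = W)) = p W"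
proof -
  have "(\<Sum>V\<in>words A L. p V * of_bool (take (length W) (drop i V) = W))
      = (\<Sum>V\<in>{V \<in> words A L. take (length W) (drop i V) = W}. p V)"
    using finite_words[OF A] by (intro sum.mono_neutral_cong_right) auto
  also have "\<dots> = (\<Sum>(X, Y)\<in>words A i \<times> words A (L - length W - i). p (X @ W @ Y))"
  proof (rule sum.reindex_bij_witness[where i = "\<lambda>(X, Y). X @ W @ Y"
        and j = "\<lambda>V. (take i V, drop (i + length W) V)"])
    fix V assume V: "V \<in> {V \<in> words A L. take (length W) (drop i V) = W}"
    have "V = take i V @ take (length W) (drop i V) @ drop (length W) (drop i V)"
      by (simp only: append_take_drop_id)
    moreover have "drop (length W) (drop i V) = drop (i + length W) V" by (simp add: add.commute)
    ultimately have *: "V = take i V @ W @ drop (i + length W) V" using V by simp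
    then show "(case (take i V, drop (i + length W) V) of (X, Y) \<Rightarrow> X @ W @ Y) = V" by simp
    show "(take i V, drop (i + length W) V) \<in> words A i \<times> words A (L - length W - i)"
      using V i by (auto simp: words_def dest: in_set_takeD in_set_dropD)
    show "(case (take i V, drop (i + length W) V) of (X, Y) \<Rightarrow> p (X @ W @ Y)) = p V"
      using * by simp
  qed (use W i in \<open>auto simp: words_def\<close>)
  also have "\<dots> = (\<Sum>Y\<in>words A (L - length W - i). \<Sum>X\<in>words A i. p (X @ W @ Y))"
    by (subst sum.swap) (simp add: sum.cartesian_product)
  also have "\<dots> = (\<Sum>Y\<in>words A (L - length W - i). p (W @ Y))"
    using W by (intro sum.cong refl sum_stationary_prefix[OF p]) (auto simp: words_def)
  also have "\<dots> = p W" by (rule sum_stationary_suffix[OF p W])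
  finally show ?thesis .
qed

text \<open>
  The expected number of occurrences of \<open>W\<close> in a random word of length \<open>L\<close>: each of the admissible
  positions contributes \<open>p W\<close>.
\<close>

lemma sum_stationary_mult:
  assumes p: "stationary A p" and W: "W \<in> lists A" and A: "finite A"
  shows "(\<Sum>V\<in>words A L. p V * real (mult V W)) = real (Suc L - length W) * p W"
proof -
  have "(\<Sum>V\<in>words A L. p V * real (mult V W))
    = (\<Sum>V\<in>words A L. \<Sum>i<Suc L - length W. p V * of_bool (take (length W) (drop i V) = W))"
    unfolding sum_distrib_left[symmetric]
    by (intro sum.cong refl) (auto simp: mult_eq_sum words_def)
  also have "\<dots> = (\<Sum>i<Suc L - length W. \<Sum>V\<in>words A L. p V * of_bool (take (length W) (drop i V) = W))"
    by (rule sum.swap)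
  also have "\<dots> = (\<Sum>i<Suc L - length W. p W)"
    by (intro sum.cong refl sum_stationary_window[OF p W _ A]) auto
  finally show ?thesis by simp
qed

section \<open>Cylinders and the Borel sets of the sequence space\<close>

lemma topspace_seq_topology: "topspace (seq_topology A) = {x. \<forall>i. x i \<in> A}"
  unfolding seq_topology_def by (simp add: PiE_UNIV_domain Pi_def)

lemma Cyl_iff: "x \<in> Cyl A W \<longleftrightarrow> (\<forall>i. x i \<in> A) \<and> (\<forall>i<length W. x i = W ! i)"
  unfolding Cyl_def topspace_seq_topology list_eq_iff_nth_eq by simp

lemma Cyl_Cons_iff: "x \<in> Cyl A (a # W) \<longleftrightarrow> x 0 = a \<and> a \<in> A \<and> left_shift x \<in> Cyl A W"
  unfolding Cyl_iff left_shift_def length_Cons All_less_Suc2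
  by (simp, metis not0_implies_Suc)

lemma Cyl_snoc_iff: "x \<in> Cyl A (W @ [a]) \<longleftrightarrow> x \<in> Cyl A W \<and> x (length W) = a"
  unfolding Cyl_iff by (auto simp: nth_append All_less_Suc)

lemma Cyl_Nil: "Cyl A [] = topspace (seq_topology A)"
  by (auto simp: Cyl_def)

lemma openin_Cyl: "openin (seq_topology A) (Cyl A W)"
proof -
  define U where "U = (\<lambda>i. if i < length W then {W ! i} \<inter> A else A)"
  have "Cyl A W = PiE UNIV U"
    unfolding U_def by (rule set_eqI) (simp add: Cyl_iff PiE_iff, meson IntD1 IntD2 IntI singletonD singletonI)
  moreover have "finite {i \<in> UNIV. U i \<noteq> A}"
  proof (rule finite_subset)
    show "{i \<in> UNIV. U i \<noteq> A} \<subseteq> {..<length W}" using not_less by (auto simp: U_def)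
  qed simp
  moreover have "U i \<subseteq> A" for i unfolding U_def by (cases "i < length W") simp_all
  ultimately show ?thesis
    unfolding seq_topology_def by (simp only: openin_PiE_gen topspace_discrete_topology openin_discrete_topology) blast
qed

text \<open>
  A basic neighbourhood of a sequence constrains only finitely many coordinates, so it contains the
  cylinder of a sufficiently long prefix.
\<close>

lemma open_eq_Union_Cyl:
  assumes "openin (seq_topology A) U"
  shows "U = \<Union>(Cyl A ` {W \<in> lists A. Cyl A W \<subseteq> U})"
proof (intro equalityI subsetI)
  fix x assume x: "x \<in> U"
  have xA: "x i \<in> A" for i
    using openin_subset[OF assms] x by (auto simp: topspace_seq_topology)
  obtain V where V: "finite {i. V i \<noteq> A}" "\<And>i. V i \<subseteq> A" "x \<in> PiE UNIV V" "PiE UNIV V \<subseteq> U"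
    using assms x unfolding seq_topology_def openin_product_topology_alt
    by (simp, metis (no_types))
  obtain n where n: "\<And>i. V i \<noteq> A \<Longrightarrow> i < n"
    using finite_nat_set_iff_bounded[of "{i. V i \<noteq> A}"] V(1) by blast
  have "Cyl A (map x [0..<n]) \<subseteq> U"
  proof
    fix y assume y: "y \<in> Cyl A (map x [0..<n])"
    have "y i \<in> V i" for i
    proof (cases "i < n")
      case True then show ?thesis using y V(3) by (auto simp: Cyl_iff)
    next
      case False then have "V i = A" using n by blast
      then show ?thesis using y by (auto simp: Cyl_iff)
    qed
    then show "y \<in> U" using V(4) by auto
  qed
  moreover have "x \<in> Cyl A (map x [0..<n])" "map x [0..<n] \<in> lists A" using xA by (auto simp: Cyl_iff)
  ultimately show "x \<in> \<Union>(Cyl A ` {W \<in> lists A. Cyl A W \<subseteq> U})" by blast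
qed auto

text \<open>
  The empty set is included so that the generator is closed under intersection.
\<close>

definition cylinders :: "'a set \<Rightarrow> (nat \<Rightarrow> 'a) set set" where
  "cylinders A = insert {} (Cyl A ` lists A)"

lemma cylinders_subset: "cylinders A \<subseteq> Pow (topspace (seq_topology A))"
  by (auto simp: cylinders_def Cyl_def)

lemma space_seq_borel: "space (seq_borel A) = topspace (seq_topology A)"
  unfolding seq_borel_def by (rule space_measure_of) (auto dest: openin_subset)

lemma sets_seq_borel:
  assumes "finite A"
  shows "sets (seq_borel A) = sigma_sets (topspace (seq_topology A)) (cylinders A)"
proof -
  have "sets (seq_borel A) = sigma_sets (topspace (seq_topology A)) {U. openin (seq_topology A) U}"
    unfolding seq_borel_def by (rule sets_measure_of) (auto dest: openin_subset)
  also have "\<dots> = sigma_sets (topspace (seq_topology A)) (cylinders A)"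
  proof (rule sigma_sets_eqI)
    fix U assume U: "U \<in> {U. openin (seq_topology A) U}"
    have "countable (lists A)" using assms by (simp add: countable_finite)
    then have "countable (Cyl A ` {W \<in> lists A. Cyl A W \<subseteq> U})"
      by (intro countable_image) (rule countable_subset, auto)
    then have "\<Union>(Cyl A ` {W \<in> lists A. Cyl A W \<subseteq> U}) \<in> sigma_sets (topspace (seq_topology A)) (cylinders A)"
      by (rule sigma_sets_UNION) (auto simp: cylinders_def intro: sigma_sets.Basic)
    then show "U \<in> sigma_sets (topspace (seq_topology A)) (cylinders A)"
      using open_eq_Union_Cyl[of A U] U by simp
  qed (auto simp: cylinders_def openin_Cyl intro: sigma_sets.Basic sigma_sets.Empty)
  finally show ?thesis .
qed

lemma sets_Cyl: "Cyl A W \<in> sets (seq_borel A)"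
  unfolding seq_borel_def using openin_Cyl by (subst sets_measure_of) (auto dest: openin_subset)

lemma Int_stable_cylinders: "Int_stable (cylinders A)"
proof (rule Int_stableI)
  have *: "Cyl A V \<inter> Cyl A W \<in> cylinders A" if "V \<in> lists A" "W \<in> lists A" "length V \<le> length W" for V W
  proof (cases "Cyl A V \<inter> Cyl A W = {}")
    case False
    then obtain x where "x \<in> Cyl A V" "x \<in> Cyl A W" by auto
    then have "V ! i = W ! i" if "i < length V" for i
      using that \<open>length V \<le> length W\<close> by (auto simp: Cyl_iff)
    then have "Cyl A V \<inter> Cyl A W = Cyl A W" using \<open>length V \<le> length W\<close> by (auto simp: Cyl_iff)
    then show ?thesis using that by (auto simp: cylinders_def)
  qed (simp add: cylinders_def)
  fix a b assume "a \<in> cylinders A" "b \<in> cylinders A"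
  then consider "a \<inter> b = {}"
    | V W where "V \<in> lists A" "W \<in> lists A" "a = Cyl A V" "b = Cyl A W"
    by (auto simp: cylinders_def)
  then show "a \<inter> b \<in> cylinders A"
  proof cases
    case 2
    then show ?thesis
      using *[of V W] *[of W V] by (cases "length V \<le> length W") (simp_all add: Int_commute)
  qed (simp add: cylinders_def)
qed

lemma measure_eq_if_Cyl_eq:
  assumes A: "finite A" and s: "sets \<mu> = sets (seq_borel A)" "sets \<nu> = sets (seq_borel A)"
    and p: "prob_space \<mu>" "prob_space \<nu>"
    and eq: "\<And>W. W \<in> lists A \<Longrightarrow> measure \<mu> (Cyl A W) = measure \<nu> (Cyl A W)"
  shows "\<mu> = \<nu>"
proof (rule measure_eqI_generator_eq[where E = "cylinders A" and A = "\<lambda>_. Cyl A []"])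
  interpret \<mu>: prob_space \<mu> by fact
  interpret \<nu>: prob_space \<nu> by fact
  show "emeasure \<mu> X = emeasure \<nu> X" if "X \<in> cylinders A" for X
    using that eq by (auto simp: cylinders_def \<mu>.emeasure_eq_measure \<nu>.emeasure_eq_measure)
  show "emeasure \<mu> (Cyl A []) \<noteq> \<infinity>" by simp
  have "Cyl A [] \<in> cylinders A" by (simp add: cylinders_def)
  then show "range (\<lambda>_. Cyl A []) \<subseteq> cylinders A" by auto
  show "cylinders A \<subseteq> Pow (topspace (seq_topology A))" by (rule cylinders_subset)
  show "(\<Union>i::nat. Cyl A []) = topspace (seq_topology A)" by (simp add: Cyl_Nil)
qed (use s sets_seq_borel[OF A] Int_stable_cylinders in simp_all)

lemma left_shift_vimage_Cyl:
  "left_shift -` Cyl A W \<inter> topspace (seq_topology A) = (\<Union>a\<in>A. Cyl A (a # W))"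
proof -
  have "(\<forall>i. x i \<in> A) \<longleftrightarrow> x 0 \<in> A \<and> (\<forall>i. left_shift x i \<in> A)" for x
  proof (intro iffI conjI allI)
    fix i assume "x 0 \<in> A \<and> (\<forall>i. left_shift x i \<in> A)"
    then show "x i \<in> A" by (cases i) (auto simp: left_shift_def)
  qed (auto simp: left_shift_def)
  moreover have "\<forall>i. left_shift x i \<in> A" if "left_shift x \<in> Cyl A W" for x
    using that unfolding Cyl_iff by blast
  ultimately have "x \<in> left_shift -` Cyl A W \<inter> topspace (seq_topology A) \<longleftrightarrow> x \<in> (\<Union>a\<in>A. Cyl A (a # W))" for x
    unfolding topspace_seq_topology UN_iff Cyl_Cons_iff Int_iff vimage_eq mem_Collect_eq by blast
  then show ?thesis by blast
qed

lemma measurable_left_shift: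
  assumes "finite A" "sets \<mu> = sets (seq_borel A)"
  shows "left_shift \<in> measurable \<mu> (seq_borel A)"
proof (rule measurable_sigma_sets[OF sets_seq_borel[OF assms(1)] cylinders_subset])
  have sp: "space \<mu> = topspace (seq_topology A)"
    using sets_eq_imp_space_eq[OF assms(2)] by (simp add: space_seq_borel)
  show "left_shift \<in> space \<mu> \<rightarrow> topspace (seq_topology A)"
    by (auto simp: sp topspace_seq_topology left_shift_def)
  show "left_shift -` y \<inter> space \<mu> \<in> sets \<mu>" if "y \<in> cylinders A" for y
  proof -
    have "(\<Union>a\<in>A. Cyl A (a # W)) \<in> sets (seq_borel A)" for W
      using assms(1) by (intro sets.finite_UN sets_Cyl)
    then show ?thesis
      using that unfolding cylinders_def sp assms(2) by (auto simp: left_shift_vimage_Cyl)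
  qed
qed

lemma measure_left_shift_Cyl:
  assumes A: "finite A" and s: "sets \<mu> = sets (seq_borel A)" and p: "prob_space \<mu>"
  shows "measure (distr \<mu> (seq_borel A) left_shift) (Cyl A W) = (\<Sum>a\<in>A. measure \<mu> (Cyl A (a # W)))"
proof -
  interpret \<mu>: prob_space \<mu> by fact
  have sp: "space \<mu> = topspace (seq_topology A)"
    using sets_eq_imp_space_eq[OF s] by (simp add: space_seq_borel)
  have "measure (distr \<mu> (seq_borel A) left_shift) (Cyl A W) = measure \<mu> (\<Union>a\<in>A. Cyl A (a # W))"
    using measure_distr[OF measurable_left_shift[OF A s] sets_Cyl] by (simp add: sp left_shift_vimage_Cyl)
  also have "\<dots> = (\<Sum>a\<in>A. measure \<mu> (Cyl A (a # W)))"
  proof (rule \<mu>.finite_measure_finite_Union[OF A])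
    show "(\<lambda>a. Cyl A (a # W)) ` A \<subseteq> sets \<mu>" using s sets_Cyl by fast
    show "disjoint_family_on (\<lambda>a. Cyl A (a # W)) A"
      unfolding disjoint_family_on_def by (auto simp: Cyl_Cons_iff)
  qed
  finally show ?thesis .
qed

lemma stationary_measure:
  assumes A: "finite A" and \<mu>: "\<mu> \<in> shift_invariant_measures A"
  shows "stationary A (\<lambda>W. measure \<mu> (Cyl A W))"
proof -
  have s: "sets \<mu> = sets (seq_borel A)" and inv: "distr \<mu> (seq_borel A) left_shift = \<mu>"
    using \<mu> by (auto simp: shift_invariant_measures_def)
  interpret \<mu>: prob_space \<mu> using \<mu> by (auto simp: shift_invariant_measures_def)
  have sp: "space \<mu> = topspace (seq_topology A)"
    using sets_eq_imp_space_eq[OF s] by (simp add: space_seq_borel)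
  have "(\<Sum>a\<in>A. measure \<mu> (Cyl A (W @ [a]))) = measure \<mu> (Cyl A W)" for W
  proof -
    have "x \<in> Cyl A W \<longleftrightarrow> x \<in> (\<Union>a\<in>A. Cyl A (W @ [a]))" for x
      unfolding UN_iff Cyl_snoc_iff by (auto simp: Cyl_iff)
    then have U: "Cyl A W = (\<Union>a\<in>A. Cyl A (W @ [a]))" by blast
    have "measure \<mu> (\<Union>a\<in>A. Cyl A (W @ [a])) = (\<Sum>a\<in>A. measure \<mu> (Cyl A (W @ [a])))"
    proof (rule \<mu>.finite_measure_finite_Union[OF A])
      show "(\<lambda>a. Cyl A (W @ [a])) ` A \<subseteq> sets \<mu>" using s sets_Cyl by fast
      show "disjoint_family_on (\<lambda>a. Cyl A (W @ [a])) A"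
        unfolding disjoint_family_on_def by (auto simp: Cyl_snoc_iff)
    qed
    then show ?thesis by (subst U) (rule sym)
  qed
  moreover have "(\<Sum>a\<in>A. measure \<mu> (Cyl A (a # W))) = measure \<mu> (Cyl A W)" for W
    using measure_left_shift_Cyl[OF A s \<mu>.prob_space_axioms, of W] inv by simp
  ultimately show ?thesis
    using \<mu>.prob_space by (simp add: stationary_def Cyl_Nil sp)
qed

section \<open>The shift-invariant measure with given stationary weights\<close>

text \<open>
  The unit interval is cut into consecutive intervals, one for each word of a given length, of
  length \<open>p W\<close> and in lexicographic order; \<open>g\<close> enumerates the letters and \<open>h\<close> is its inverse.  The
  left end point of the interval of \<open>W\<close> is the total weight of the words that follow \<open>W\<close> up to some
  position \<open>i\<close> and end there with a smaller letter.
\<close>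

definition cell_start :: "('a \<Rightarrow> nat) \<Rightarrow> (nat \<Rightarrow> 'a) \<Rightarrow> ('a list \<Rightarrow> real) \<Rightarrow> 'a list \<Rightarrow> real" where
  "cell_start h g p W = (\<Sum>i<length W. \<Sum>j<h (W ! i). p (take i W @ [g j]))"

definition cell :: "('a \<Rightarrow> nat) \<Rightarrow> (nat \<Rightarrow> 'a) \<Rightarrow> ('a list \<Rightarrow> real) \<Rightarrow> 'a list \<Rightarrow> real set" where
  "cell h g p W = {cell_start h g p W ..< cell_start h g p W + p W}"

lemma cell_start_snoc:
  "cell_start h g p (W @ [a]) = cell_start h g p W + (\<Sum>j<h a. p (W @ [g j]))"
  by (simp add: cell_start_def nth_append)

lemma ex1_partial_sum_interval:
  fixes q :: "nat \<Rightarrow> real"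
  assumes q: "\<And>j. j < k \<Longrightarrow> 0 \<le> q j" and t: "0 \<le> t" "t < (\<Sum>j<k. q j)"
  shows "\<exists>!i. i < k \<and> (\<Sum>j<i. q j) \<le> t \<and> t < (\<Sum>j<i. q j) + q i"
proof -
  define P where "P m \<longleftrightarrow> t < (\<Sum>j<Suc m. q j)" for m
  define i where "i = (LEAST m. P m)"
  obtain k' where k': "k = Suc k'" using t by (cases k) auto
  have "P k'" using t k' unfolding P_def by blast
  then have "P i" "i \<le> k'" unfolding i_def by (rule LeastI, rule Least_le)
  have i: "t < (\<Sum>j<i. q j) + q i" using \<open>P i\<close> by (simp add: P_def)
  note \<open>i \<le> k'\<close>
  moreover have "(\<Sum>j<i. q j) \<le> t"
  proof (cases i)
    case (Suc m)
    then have "\<not> P m" using not_less_Least[of m P] by (simp add: i_def)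
    then show ?thesis using Suc by (simp add: P_def)
  qed (use t in simp)
  moreover have mono: "(\<Sum>j<a. q j) + q a \<le> (\<Sum>j<b. q j)" if "a < b" "b < k" for a b
  proof -
    have "(\<Sum>j<Suc a. q j) \<le> (\<Sum>j<b. q j)" using that q by (intro sum_mono2) auto
    then show ?thesis by simp
  qed
  moreover have "l = i" if "l < k" "(\<Sum>j<l. q j) \<le> t" "t < (\<Sum>j<l. q j) + q l" for l
    using mono[of l i] mono[of i l] that i \<open>i \<le> k'\<close> \<open>(\<Sum>j<i. q j) \<le> t\<close> k'
    by (cases l i rule: linorder_cases) auto
  ultimately show ?thesis using i k' by (intro ex1I[of _ i]) auto
qed

context
  fixes A :: "'a set" and p h g
  assumes p: "stationary A p" and g: "bij_betw g {..<card A} A"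
    and h: "\<And>j. j < card A \<Longrightarrow> h (g j) = j"
begin

lemma h_less: "a \<in> A \<Longrightarrow> h a < card A \<and> g (h a) = a"
proof -
  assume "a \<in> A"
  then obtain j where "j < card A" "a = g j" using g by (auto simp: bij_betw_def)
  then show ?thesis using h by simp
qed

lemma sum_letters: "(\<Sum>j<card A. f (g j)) = (\<Sum>a\<in>A. f a)"
  by (rule sum.reindex_bij_betw[OF g])

lemma cell_split:
  assumes W: "W \<in> lists A" and t: "t \<in> cell h g p W"
  shows "\<exists>!a. a \<in> A \<and> t \<in> cell h g p (W @ [a])"
proof -
  define s where "s = t - cell_start h g p W"
  have gA: "g j \<in> A" if "j < card A" for j using g that by (auto simp: bij_betw_def)
  have "(\<Sum>j<card A. p (W @ [g j])) = p W"
    using sum_letters[of "\<lambda>a. p (W @ [a])"] p W by (simp add: stationary_def)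
  moreover define Q where "Q i \<longleftrightarrow> (\<Sum>j<i. p (W @ [g j])) \<le> s \<and> s < (\<Sum>j<i. p (W @ [g j])) + p (W @ [g i])" for i
  ultimately have "\<exists>!i. i < card A \<and> Q i"
    unfolding Q_def using t W p gA
    by (intro ex1_partial_sum_interval) (auto simp: cell_def s_def stationary_def)
  then obtain i where i: "i < card A" "Q i" "\<And>j. j < card A \<Longrightarrow> Q j \<Longrightarrow> j = i" by blast
  have *: "t \<in> cell h g p (W @ [a]) \<longleftrightarrow> Q (h a)" if "a \<in> A" for a
    using h_less[OF that] by (simp add: cell_def cell_start_snoc s_def Q_def) linarith
  show ?thesis
  proof (intro ex1I[of _ "g i"] conjI)
    show "t \<in> cell h g p (W @ [g i])" using *[OF gA[OF i(1)]] h[OF i(1)] i(2) by simp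
    fix a assume a: "a \<in> A \<and> t \<in> cell h g p (W @ [a])"
    then have "Q (h a)" "h a < card A" "g (h a) = a" using * h_less by blast+
    moreover from this have "h a = i" by (intro i(3))
    ultimately show "a = g i" by simp
  qed (rule gA[OF i(1)])
qed

lemma cell_snoc_subset:
  assumes W: "W \<in> lists A" and a: "a \<in> A"
  shows "cell h g p (W @ [a]) \<subseteq> cell h g p W"
proof -
  have gA: "g j \<in> A" if "j < card A" for j using g that by (auto simp: bij_betw_def)
  have pos: "0 \<le> p (W @ [g j])" if "j < card A" for j using p W gA[OF that] by (simp add: stationary_def)
  have "(\<Sum>j<h a. p (W @ [g j])) + p (W @ [a]) = (\<Sum>j<Suc (h a). p (W @ [g j]))"
    using h_less[OF a] by simp
  also have "\<dots> \<le> (\<Sum>j<card A. p (W @ [g j]))"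
    using h_less[OF a] pos by (intro sum_mono2) auto
  also have "\<dots> = p W"
    using sum_letters[of "\<lambda>a. p (W @ [a])"] p W by (simp add: stationary_def)
  finally have "(\<Sum>j<h a. p (W @ [g j])) + p (W @ [a]) \<le> p W" .
  moreover have "0 \<le> (\<Sum>j<h a. p (W @ [g j]))" using h_less[OF a] pos by (intro sum_nonneg) auto
  ultimately show ?thesis by (auto simp: cell_def cell_start_snoc)
qed

lemma words_Suc_cases:
  assumes "V \<in> words A (Suc n)"
  obtains W a where "V = W @ [a]" "W \<in> words A n" "a \<in> A"
  using assms by (cases V rule: rev_exhaust) (simp_all add: words_def)

lemma cell_Nil: "cell h g p [] = {0..<1}"
  using p by (simp add: cell_def cell_start_def stationary_def)

lemma cell_subset: "W \<in> lists A \<Longrightarrow> cell h g p W \<subseteq> {0..<1}"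
proof (induction W rule: rev_induct)
  case (snoc a W)
  then show ?case using cell_snoc_subset[of W a] by auto
qed (simp add: cell_Nil)

lemma ex1_cell:
  assumes t: "t \<in> {0..<1}"
  shows "\<exists>!W. W \<in> words A n \<and> t \<in> cell h g p W"
proof (induction n)
  case 0
  show ?case using t by (auto simp: words_0 cell_Nil)
next
  case (Suc n)
  then obtain W where W: "W \<in> words A n" "t \<in> cell h g p W"
    and Wu: "\<And>V. V \<in> words A n \<Longrightarrow> t \<in> cell h g p V \<Longrightarrow> V = W" by metis
  have WA: "W \<in> lists A" using W by (simp add: words_def)
  obtain a where a: "a \<in> A" "t \<in> cell h g p (W @ [a])"
    and au: "\<And>b. b \<in> A \<Longrightarrow> t \<in> cell h g p (W @ [b]) \<Longrightarrow> b = a"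
    using cell_split[OF WA W(2)] by metis
  show ?case
  proof (intro ex1I[of _ "W @ [a]"] conjI)
    fix V assume V: "V \<in> words A (Suc n) \<and> t \<in> cell h g p V"
    then obtain V' b where Vb: "V = V' @ [b]" "V' \<in> words A n" "b \<in> A"
      using words_Suc_cases by blast
    have "V' \<in> lists A" using Vb(2) by (simp add: words_def)
    moreover have "t \<in> cell h g p (V' @ [b])" using V unfolding Vb(1) ..
    ultimately have "t \<in> cell h g p V'" using cell_snoc_subset Vb(3) by (meson subsetD)
    then have "V' = W" by (rule Wu[OF Vb(2)])
    then have VW: "V = W @ [b]" using Vb(1) by simp
    have "t \<in> cell h g p (W @ [b])" using V unfolding VW ..
    then have "b = a" by (rule au[OF Vb(3)])
    then show "V = W @ [a]" using VW by simp
  next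
    show "W @ [a] \<in> words A (Suc n)" using W(1) a(1) by (simp add: words_def)
    show "t \<in> cell h g p (W @ [a])" by (rule a(2))
  qed
qed

text \<open>
  The words whose cells contain \<open>t\<close>, one of each length, are prefixes of each other because cells are
  nested; \<open>x\<close> is the sequence that they form.
\<close>

lemma ex_coding:
  assumes t: "t \<in> {0..<1}"
  shows "\<exists>x \<in> topspace (seq_topology A). \<forall>W\<in>lists A. x \<in> Cyl A W \<longleftrightarrow> t \<in> cell h g p W"
proof -
  define c where "c n = (THE W. W \<in> words A n \<and> t \<in> cell h g p W)" for n
  have c: "c n \<in> words A n" "t \<in> cell h g p (c n)" for n
    using theI'[OF ex1_cell[OF t, of n]] unfolding c_def by blast+
  have cu: "W = c n" if "W \<in> words A n" "t \<in> cell h g p W" for n W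
    using ex1_cell[OF t, of n] c[of n] that by blast
  define x where "x i = c (Suc i) ! i" for i
  have xA: "x i \<in> A" for i
    using c(1)[of "Suc i"] by (auto simp: x_def words_def in_lists_conv_set)
  have step: "c (Suc n) = c n @ [x n]" for n
  proof -
    obtain V b where Vb: "c (Suc n) = V @ [b]" "V \<in> words A n" "b \<in> A"
      using c(1)[of "Suc n"] words_Suc_cases by blast
    have "V \<in> lists A" using Vb(2) by (simp add: words_def)
    moreover have "t \<in> cell h g p (V @ [b])" using c(2)[of "Suc n"] unfolding Vb(1) .
    ultimately have "t \<in> cell h g p V" using cell_snoc_subset Vb(3) by (meson subsetD)
    then have "V = c n" by (rule cu[OF Vb(2)])
    then show ?thesis using Vb c(1)[of n] by (simp add: x_def words_def nth_append)
  qed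
  have map: "map x [0..<n] = c n" for n
  proof (induction n)
    case 0 show ?case using c(1)[of 0] by (simp add: words_def)
  next
    case (Suc n) then show ?case unfolding step by simp
  qed
  have Cyl: "x \<in> Cyl A W \<longleftrightarrow> t \<in> cell h g p W" if "W \<in> lists A" for W
  proof -
    have "x \<in> Cyl A W \<longleftrightarrow> c (length W) = W"
      using xA map[of "length W"] by (simp add: Cyl_def topspace_seq_topology)
    also have "\<dots> \<longleftrightarrow> t \<in> cell h g p W"
    proof
      show "t \<in> cell h g p W" if "c (length W) = W" using c(2)[of "length W"] that by simp
      show "c (length W) = W" if "t \<in> cell h g p W"
        using cu[of W "length W"] that \<open>W \<in> lists A\<close> by (simp add: words_def)
    qed
    finally show ?thesis .
  qed
  show ?thesis
  proof (intro bexI ballI)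
    show "x \<in> topspace (seq_topology A)" using xA by (simp add: topspace_seq_topology)
    show "x \<in> Cyl A W \<longleftrightarrow> t \<in> cell h g p W" if "W \<in> lists A" for W
      by (rule Cyl[OF that])
  qed
qed

end

text \<open>
  The coding of points of \<open>[0,1)\<close> by sequences pulls the cylinder of \<open>W\<close> back to the cell of \<open>W\<close>, so
  the image of Lebesgue measure gives it mass \<open>p W\<close>.  Left additivity makes this measure
  and its image under the shift agree on cylinders.
\<close>

theorem ex_measure_of_stationary:
  assumes A: "finite A" and p: "stationary A p"
  shows "\<exists>\<mu>\<in>shift_invariant_measures A. \<forall>W\<in>lists A. measure \<mu> (Cyl A W) = p W"
proof -
  obtain g where g: "bij_betw g {..<card A} A"
    using ex_bij_betw_nat_finite[OF A] unfolding atLeast0LessThan by blast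
  define h where "h = inv_into {..<card A} g"
  have h: "h (g j) = j" if "j < card A" for j
    unfolding h_def using g that by (simp add: bij_betw_def)
  note ctx = p g h
  have "\<forall>t\<in>{0..<1}. \<exists>x. x \<in> topspace (seq_topology A) \<and> (\<forall>W\<in>lists A. x \<in> Cyl A W \<longleftrightarrow> t \<in> cell h g p W)"
    using ex_coding[OF ctx] by (simp only: Bex_def) simp
  from bchoice[OF this] obtain T where T: "\<And>t. t \<in> {0..<1} \<Longrightarrow> T t \<in> topspace (seq_topology A)"
    and TC: "\<And>t W. t \<in> {0..<1} \<Longrightarrow> W \<in> lists A \<Longrightarrow> T t \<in> Cyl A W \<longleftrightarrow> t \<in> cell h g p W"
    by blast
  define M where "M = restrict_space lborel {0..<1::real}"
  have spM: "space M = {0..<1}" by (simp add: M_def space_restrict_space)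
  interpret M: prob_space M
    unfolding M_def by (rule prob_space_restrict_space) auto
  have cellM: "cell h g p W \<in> sets M" if "W \<in> lists A" for W
    using cell_subset[OF ctx that] unfolding M_def by (simp add: sets_restrict_space_iff cell_def)
  have pre: "T -` Cyl A W \<inter> space M = cell h g p W" if "W \<in> lists A" for W
    unfolding spM using TC[OF _ that] cell_subset[OF ctx that] by blast
  have meas: "T \<in> measurable M (seq_borel A)"
  proof (rule measurable_sigma_sets[OF sets_seq_borel[OF A] cylinders_subset])
    show "T \<in> space M \<rightarrow> topspace (seq_topology A)" unfolding spM using T by blast
    show "T -` y \<inter> space M \<in> sets M" if y: "y \<in> cylinders A" for y
    proof (cases "y = {}")
      case False
      then obtain W where "W \<in> lists A" "y = Cyl A W" using y by (auto simp: cylinders_def)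
      then show ?thesis using pre[of W] cellM[of W] by simp
    qed simp
  qed
  define \<mu> where "\<mu> = distr M (seq_borel A) T"
  have s: "sets \<mu> = sets (seq_borel A)" by (simp add: \<mu>_def)
  have prob: "prob_space \<mu>" unfolding \<mu>_def by (rule M.prob_space_distr[OF meas])
  have Cyl: "measure \<mu> (Cyl A W) = p W" if W: "W \<in> lists A" for W
  proof -
    have "measure \<mu> (Cyl A W) = measure M (cell h g p W)"
      unfolding \<mu>_def measure_distr[OF meas sets_Cyl] pre[OF W] ..
    also have "\<dots> = measure lborel (cell h g p W)"
      unfolding M_def using cell_subset[OF ctx W] by (intro measure_restrict_space) auto
    also have "\<dots> = p W" using p W by (simp add: cell_def stationary_def)
    finally show ?thesis .
  qed
  have "distr \<mu> (seq_borel A) left_shift = \<mu>"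
  proof (rule measure_eq_if_Cyl_eq[OF A])
    show "prob_space (distr \<mu> (seq_borel A) left_shift)"
      by (rule prob_space.prob_space_distr[OF prob measurable_left_shift[OF A s]])
    show "measure (distr \<mu> (seq_borel A) left_shift) (Cyl A W) = measure \<mu> (Cyl A W)"
      if "W \<in> lists A" for W
    proof -
      have "measure (distr \<mu> (seq_borel A) left_shift) (Cyl A W) = (\<Sum>a\<in>A. p (a # W))"
        unfolding measure_left_shift_Cyl[OF A s prob] using that by (intro sum.cong refl Cyl) auto
      also have "\<dots> = p W" using p that unfolding stationary_def by blast
      finally show ?thesis unfolding Cyl[OF that] .
    qed
  qed (use s prob in auto)
  then show ?thesis
    using s prob Cyl by (intro bexI[of _ \<mu>]) (auto simp: shift_invariant_measures_def)
qed

section \<open>The extended distance is a metric\<close>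

text \<open>
  The additional coordinate \<open>None\<close> is \<open>1\<close> exactly when the frequency vector vanishes.  Vanishing
  vectors thus become one common unit vector orthogonal to all others, which reproduces the values
  \<open>0\<close> and \<open>\<pi>/2\<close> prescribed for them.
\<close>

definition padded :: "'a set \<Rightarrow> nat \<Rightarrow> 'a ext \<Rightarrow> 'a list option \<Rightarrow> real" where
  "padded A n X i = (case i of
     None \<Rightarrow> of_bool (vanishes (words A n) (word_freq A n X)) | Some W \<Rightarrow> unit_freq A n X W)"

definition padded_words :: "'a set \<Rightarrow> nat \<Rightarrow> 'a list option set" where
  "padded_words A n = insert None (Some ` words A n)"

lemma padded_simps [simp]:
  "padded A n X None = of_bool (vanishes (words A n) (word_freq A n X))"
  "padded A n X (Some W) = unit_freq A n X W"
  by (simp_all add: padded_def)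

lemma sum_padded_words:
  assumes "finite A"
  shows "(\<Sum>i\<in>padded_words A n. f i) = f None + (\<Sum>W\<in>words A n. f (Some W))"
  unfolding padded_words_def using finite_words[OF assms, of n]
  by (subst sum.insert) (auto simp: sum.reindex)

lemma word_freq_nonneg: "0 \<le> word_freq A n X W"
  by (simp add: word_freq_def split: sum.split)

lemma L2_word_freq_pos:
  assumes "finite A" "\<not> vanishes (words A n) (word_freq A n X)"
  shows "0 < L2_set (word_freq A n X) (words A n)"
proof -
  have "L2_set (word_freq A n X) (words A n) \<noteq> 0"
    using assms L2_set_eq_0_iff[OF finite_words[OF assms(1)]] unfolding vanishes_def by blast
  then show ?thesis using L2_set_nonneg[of "word_freq A n X" "words A n"] by linarith
qed

lemma unit_freq_nonneg: "0 \<le> unit_freq A n X W"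
  by (simp add: unit_freq_def word_freq_nonneg)

lemma unit_freq_eq:
  assumes "W \<in> words A n"
  shows "unit_freq A n X W = word_freq A n X W / L2_set (word_freq A n X) (words A n)"
  using assms by (simp add: unit_freq_def vanishes_def)

lemma vanishes_unit_freq:
  assumes "finite A"
  shows "vanishes (words A n) (unit_freq A n X) \<longleftrightarrow> vanishes (words A n) (word_freq A n X)"
proof (cases "vanishes (words A n) (word_freq A n X)")
  case False
  then show ?thesis
    using L2_word_freq_pos[OF assms False] by (simp add: vanishes_def unit_freq_def)
qed (simp add: vanishes_def unit_freq_def)

lemma unit_vec_padded:
  assumes "finite A"
  shows "unit_vec (padded_words A n) (padded A n X)"
proof -
  have "dot (padded_words A n) (padded A n X) (padded A n X) = 1"
  proof (cases "vanishes (words A n) (word_freq A n X)")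
    case True
    then show ?thesis by (simp add: dot_def sum_padded_words[OF assms] unit_freq_def)
  next
    case False
    let ?N = "L2_set (word_freq A n X) (words A n)"
    have "(\<Sum>W\<in>words A n. unit_freq A n X W * unit_freq A n X W)
        = (\<Sum>W\<in>words A n. (word_freq A n X W)\<^sup>2) / ?N\<^sup>2"
      using False by (simp add: unit_freq_def sum_divide_distrib power2_eq_square)
    also have "(\<Sum>W\<in>words A n. (word_freq A n X W)\<^sup>2) = ?N\<^sup>2"
      by (simp add: L2_set_def sum_nonneg)
    finally show ?thesis
      using False L2_word_freq_pos[OF assms False] by (simp add: dot_def sum_padded_words[OF assms])
  qed
  moreover have "finite (padded_words A n)" using finite_words[OF assms] by (simp add: padded_words_def)
  moreover have "0 \<le> padded A n X i" for i by (cases i) (simp_all add: unit_freq_nonneg)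
  ultimately show ?thesis by (simp add: unit_vec_def)
qed

lemma theta_ext_eq:
  assumes "finite A"
  shows "theta_ext A n X Y = arccos (dot (padded_words A n) (padded A n X) (padded A n Y))"
  using vanishes_unit_freq[OF assms, of n X] vanishes_unit_freq[OF assms, of n Y]
  by (simp add: theta_ext_def Let_def dot_def sum_padded_words[OF assms] unit_freq_def)

lemma theta_ext_bounds:
  assumes "finite A"
  shows "0 \<le> theta_ext A n X Y" "theta_ext A n X Y \<le> pi / 2"
  unfolding theta_ext_eq[OF assms]
  by (intro arccos_nonneg_bounds dot_unit_vec unit_vec_padded assms)+

lemma theta_ext_commute: "finite A \<Longrightarrow> theta_ext A n X Y = theta_ext A n Y X"
  by (simp add: theta_ext_eq dot_commute)

lemma theta_ext_triangle:
  "finite A \<Longrightarrow> theta_ext A n X Z \<le> theta_ext A n X Y + theta_ext A n Y Z"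
  unfolding theta_ext_eq by (intro arccos_dot_triangle unit_vec_padded)

lemma padded_diff_le:
  assumes "finite A" "i \<in> padded_words A n"
  shows "\<bar>padded A n X i - padded A n Y i\<bar> \<le> theta_ext A n X Y"
  unfolding theta_ext_eq[OF assms(1)]
  by (intro coordinate_diff_le_arccos_dot unit_vec_padded assms)

lemma theta_ext_self: "finite A \<Longrightarrow> theta_ext A n X X = 0"
  using unit_vec_padded[of A n X] by (simp add: theta_ext_eq unit_vec_def)

context
  fixes A :: "'a set" and \<rho> :: real
  assumes A: "finite A" and \<rho>: "0 < \<rho>" "\<rho> < 1"
begin

lemma summable_bound: "summable (\<lambda>n. \<rho> ^ Suc n * (pi / 2))"
  using \<rho> by (intro summable_mult2) (simp add: summable_geometric summable_mult)

lemma summable_d_hat: "summable (\<lambda>n. \<rho> ^ Suc n * theta_ext A (Suc n) X Y)"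
  using \<rho> theta_ext_bounds[OF A]
  by (intro summable_comparison_test'[OF summable_bound, of 0])
    (auto simp: abs_mult intro!: mult_left_mono)

lemma d_hat_nonneg: "0 \<le> d_hat A \<rho> X Y"
  unfolding d_hat_def using \<rho> theta_ext_bounds[OF A] by (intro suminf_nonneg summable_d_hat) simp

lemma d_hat_commute: "d_hat A \<rho> X Y = d_hat A \<rho> Y X"
  unfolding d_hat_def by (simp add: theta_ext_commute[OF A, of _ X Y])

lemma d_hat_self: "d_hat A \<rho> X X = 0"
  unfolding d_hat_def by (simp add: theta_ext_self[OF A])

lemma d_hat_triangle: "d_hat A \<rho> X Z \<le> d_hat A \<rho> X Y + d_hat A \<rho> Y Z"
proof -
  have "d_hat A \<rho> X Z \<le> (\<Sum>n. \<rho> ^ Suc n * theta_ext A (Suc n) X Y + \<rho> ^ Suc n * theta_ext A (Suc n) Y Z)"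
    unfolding d_hat_def
  proof (intro suminf_le summable_add summable_d_hat)
    fix n
    show "\<rho> ^ Suc n * theta_ext A (Suc n) X Z
        \<le> \<rho> ^ Suc n * theta_ext A (Suc n) X Y + \<rho> ^ Suc n * theta_ext A (Suc n) Y Z"
      unfolding distrib_left[symmetric] using \<rho> theta_ext_triangle[OF A]
      by (intro mult_left_mono) simp_all
  qed
  then show ?thesis
    unfolding d_hat_def by (simp only: suminf_add[OF summable_d_hat summable_d_hat])
qed

lemma theta_ext_le_d_hat: "\<rho> ^ Suc n * theta_ext A (Suc n) X Y \<le> d_hat A \<rho> X Y"
proof -
  have "(\<Sum>i\<in>{n}. \<rho> ^ Suc i * theta_ext A (Suc i) X Y) \<le> d_hat A \<rho> X Y"
    unfolding d_hat_def using \<rho> theta_ext_bounds[OF A]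
    by (intro sum_le_suminf summable_d_hat) simp_all
  then show ?thesis by simp
qed

text \<open>
  Limit and sum may be exchanged because the terms are dominated by the geometric series
  \<open>\<rho>\<^sup>n \<pi>/2\<close>.
\<close>

lemma d_hat_tendsto_0:
  assumes "\<And>n. (\<lambda>k. theta_ext A (Suc n) (X k) Y) \<longlonglongrightarrow> 0"
  shows "(\<lambda>k. d_hat A \<rho> (X k) Y) \<longlonglongrightarrow> 0"
proof -
  have lim: "(\<lambda>k. \<rho> ^ Suc n * theta_ext A (Suc n) (X k) Y) \<longlonglongrightarrow> 0" for n
    using tendsto_mult_right_zero[OF assms[of n]] .
  have "\<forall>\<^sub>F (n, k) in at_top \<times>\<^sub>F sequentially.
      norm (\<rho> ^ Suc n * theta_ext A (Suc n) (X k) Y) \<le> \<rho> ^ Suc n * (pi / 2)"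
    using \<rho> theta_ext_bounds[OF A]
    by (intro always_eventually) (auto simp: abs_mult intro!: mult_left_mono)
  from tannerys_theorem[OF lim this summable_bound]
  show ?thesis by (simp add: d_hat_def)
qed

end

lemma vanishes_iff_sum_0:
  fixes f :: "'b \<Rightarrow> real"
  assumes "finite I" "\<And>i. i \<in> I \<Longrightarrow> 0 \<le> f i"
  shows "vanishes I f \<longleftrightarrow> sum f I = 0"
  using sum_nonneg_eq_0_iff[OF assms] by (simp add: vanishes_def)

lemma vanishes_mult:
  assumes "finite A" "S \<in> lists A"
  shows "vanishes (words A n) (\<lambda>W. real (mult S W)) \<longleftrightarrow> length S < n"
  using finite_words[OF assms(1)] by (subst vanishes_iff_sum_0) (auto simp: sum_mult_words[OF assms])

lemma vanishes_word_freq_Inl: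
  assumes "finite A" "S \<in> lists A"
  shows "vanishes (words A n) (word_freq A n (Inl S)) \<longleftrightarrow> length S < n"
proof (cases "n \<le> length S")
  case True
  have "vanishes (words A n) (word_freq A n (Inl S)) \<longleftrightarrow> vanishes (words A n) (\<lambda>W. real (mult S W))"
    using True by (simp add: vanishes_def word_freq_def)
  then show ?thesis using vanishes_mult[OF assms] by simp
qed (simp add: vanishes_def word_freq_def)

lemma sum_word_freq:
  assumes A: "finite A" and X: "X \<in> ext_space A" and nz: "\<not> vanishes (words A n) (word_freq A n X)"
  shows "(\<Sum>W\<in>words A n. word_freq A n X W) = 1"
proof (cases X)
  case (Inl S)
  then have S: "S \<in> lists A" using X by (auto simp: ext_space_def)
  have "n \<le> length S" using nz vanishes_word_freq_Inl[OF A S, of n] Inl by simp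
  moreover from this have "(\<Sum>W\<in>words A n. real (mult S W)) = real (length S - n + 1)"
    using sum_mult_words[OF A S, of n] by (simp add: Suc_diff_le)
  ultimately show ?thesis by (simp add: Inl word_freq_def flip: sum_divide_distrib)
next
  case (Inr \<mu>)
  then have "\<mu> \<in> shift_invariant_measures A" using X by (auto simp: ext_space_def)
  from sum_stationary_words[OF stationary_measure[OF A this]]
  show ?thesis by (simp add: Inr word_freq_def)
qed

lemma vanishes_word_freq_Inr:
  assumes "finite A" "\<mu> \<in> shift_invariant_measures A"
  shows "\<not> vanishes (words A n) (word_freq A n (Inr \<mu>))"
proof
  assume "vanishes (words A n) (word_freq A n (Inr \<mu>))"
  then have "(\<Sum>W\<in>words A n. measure \<mu> (Cyl A W)) = 0"
    by (intro sum.neutral) (simp add: vanishes_def word_freq_def)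
  then show False using sum_stationary_words[OF stationary_measure[OF assms], of n] by simp
qed

text \<open>
  Normalising a vector loses only its scale, and the scale is fixed by the entries summing to \<open>1\<close>.
\<close>

lemma word_freq_eq_unit_freq:
  assumes A: "finite A" and X: "X \<in> ext_space A" and nz: "\<not> vanishes (words A n) (word_freq A n X)"
  shows "word_freq A n X W = unit_freq A n X W / (\<Sum>V\<in>words A n. unit_freq A n X V)"
proof -
  let ?N = "L2_set (word_freq A n X) (words A n)"
  have "(\<Sum>V\<in>words A n. unit_freq A n X V) = 1 / ?N"
    using nz sum_word_freq[OF assms] by (simp add: unit_freq_def flip: sum_divide_distrib)
  then show ?thesis using nz L2_word_freq_pos[OF A nz] by (simp add: unit_freq_def)
qed

lemma word_freq_0:
  assumes "finite A" "X \<in> ext_space A"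
  shows "word_freq A 0 X [] = 1"
proof (cases X)
  case (Inl S)
  have "mult S [] = Suc (length S)"
    using mult_eq_sum[of S "[]"] by simp
  then show ?thesis by (simp add: Inl word_freq_def)
next
  case (Inr \<mu>)
  then have "\<mu> \<in> shift_invariant_measures A" using assms(2) by (auto simp: ext_space_def)
  from stationary_measure[OF assms(1) this] show ?thesis by (simp add: Inr word_freq_def stationary_def)
qed

text \<open>
  The vector of a string vanishes exactly for \<open>n\<close> above its length, that of a measure never.
  Equal data therefore force two strings to have the same length \<open>L\<close>, and the vector of order \<open>L\<close> of a
  string of length \<open>L\<close> is the indicator of that string.  Two measures with equal vectors agree on all
  cylinders.
\<close>

lemma ext_eqI:
  assumes A: "finite A" and X: "X \<in> ext_space A" and Y: "Y \<in> ext_space A"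
    and eq: "\<And>n i. n > 0 \<Longrightarrow> i \<in> padded_words A n \<Longrightarrow> padded A n X i = padded A n Y i"
  shows "X = Y"
proof -
  have van: "vanishes (words A n) (word_freq A n X) \<longleftrightarrow> vanishes (words A n) (word_freq A n Y)"
    if "n > 0" for n
    using eq[OF that, of None] by (auto simp: padded_words_def split: if_splits)
  have unit: "unit_freq A n X W = unit_freq A n Y W" if "n > 0" "W \<in> words A n" for n W
    using eq[OF that(1), of "Some W"] that(2) by (simp add: padded_words_def)
  have freq: "word_freq A n X W = word_freq A n Y W"
    if n: "n > 0" and W: "W \<in> words A n" and nz: "\<not> vanishes (words A n) (word_freq A n X)" for n W
  proof -
    have "(\<Sum>V\<in>words A n. unit_freq A n X V) = (\<Sum>V\<in>words A n. unit_freq A n Y V)"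
      using unit[OF n] by (rule sum.cong[OF refl])
    then show ?thesis
      using word_freq_eq_unit_freq[OF A X nz, of W] word_freq_eq_unit_freq[OF A Y, of n W]
        nz van[OF n] unit[OF n W] by simp
  qed
  show ?thesis
  proof (cases X; cases Y)
    fix S T assume XY: "X = Inl S" "Y = Inl T"
    then have ST: "S \<in> lists A" "T \<in> lists A" using X Y by (auto simp: ext_space_def)
    have len: "length S < n \<longleftrightarrow> length T < n" if "n > 0" for n
      using van[OF that] vanishes_word_freq_Inl[OF A] XY ST by blast
    have L: "length S = length T" using len[of "length S"] len[of "length T"] by linarith
    show "X = Y"
    proof (cases "S = []")
      case False
      have nv: "\<not> vanishes (words A (length S)) (word_freq A (length S) X)"
        using vanishes_word_freq_Inl[OF A ST(1)] XY by simp
      have "word_freq A (length S) X S = word_freq A (length S) Y S"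
        using False ST by (intro freq nv) (auto simp: words_def)
      then have "real (mult S S) = real (mult T S)" by (simp add: XY word_freq_def L)
      then have "of_bool (T = S) = (1 :: real)" unfolding mult_eq_sum by (simp add: L)
      then show ?thesis using XY by (simp split: if_splits)
    qed (use L XY in simp)
  next
    fix S \<nu> assume XY: "X = Inl S" "Y = Inr \<nu>"
    then show "X = Y"
      using van[of "Suc (length S)"] vanishes_word_freq_Inl[OF A, of S] vanishes_word_freq_Inr[OF A, of \<nu>] X Y
      by (auto simp: ext_space_def)
  next
    fix \<mu> T assume XY: "X = Inr \<mu>" "Y = Inl T"
    then show "X = Y"
      using van[of "Suc (length T)"] vanishes_word_freq_Inl[OF A, of T] vanishes_word_freq_Inr[OF A, of \<mu>] X Y
      by (auto simp: ext_space_def)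
  next
    fix \<mu> \<nu> assume XY: "X = Inr \<mu>" "Y = Inr \<nu>"
    then have m: "\<mu> \<in> shift_invariant_measures A" "\<nu> \<in> shift_invariant_measures A"
      using X Y by (auto simp: ext_space_def)
    have "measure \<mu> (Cyl A W) = measure \<nu> (Cyl A W)" if W: "W \<in> lists A" for W
    proof (cases "W = []")
      case True
      then show ?thesis using word_freq_0[OF A X] word_freq_0[OF A Y] XY by (simp add: word_freq_def)
    next
      case False
      have "word_freq A (length W) X W = word_freq A (length W) Y W"
        using False W vanishes_word_freq_Inr[OF A m(1)] XY by (intro freq) (auto simp: words_def)
      then show ?thesis by (simp add: XY word_freq_def)
    qed
    then have "\<mu> = \<nu>"
      using m by (intro measure_eq_if_Cyl_eq[OF A]) (auto simp: shift_invariant_measures_def)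
    then show "X = Y" by (simp add: XY)
  qed
qed

theorem Metric_space_d_hat:
  assumes A: "finite A" and \<rho>: "0 < \<rho>" "\<rho> < 1"
  shows "Metric_space (ext_space A) (d_hat A \<rho>)"
proof
  fix X Y assume XY: "X \<in> ext_space A" "Y \<in> ext_space A"
  show "d_hat A \<rho> X Y = 0 \<longleftrightarrow> X = Y"
  proof
    assume d: "d_hat A \<rho> X Y = 0"
    show "X = Y"
    proof (rule ext_eqI[OF A XY])
      fix n :: nat and i assume n: "n > 0" and i: "i \<in> padded_words A n"
      obtain m where m: "n = Suc m" using n by (cases n) auto
      have "\<rho> ^ Suc m * theta_ext A (Suc m) X Y \<le> 0"
        using theta_ext_le_d_hat[OF assms, of m X Y] d by simp
      then have "theta_ext A n X Y \<le> 0" using \<rho> zero_less_power[of \<rho> "Suc m"] unfolding m mult_le_0_iff by linarith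
      then show "padded A n X i = padded A n Y i" using padded_diff_le[OF A i, of X Y] by simp
    qed
  qed (simp add: d_hat_self[OF assms])
qed (rule d_hat_nonneg[OF assms] d_hat_commute[OF assms] d_hat_triangle[OF assms])+

lemma word_freq_Inl_eq_mult:
  "\<exists>c>0. \<forall>W\<in>words A n. word_freq A n (Inl S) W = c * real (mult S W)"
proof (cases "n \<le> length S")
  case True
  then show ?thesis
    by (intro exI[of _ "1 / real (length S - n + 1)"]) (simp add: word_freq_def)
next
  case False
  then have "mult S W = 0" if "W \<in> words A n" for W
    using mult_le[of S W] that by (simp add: words_def)
  then show ?thesis using False by (intro exI[of _ 1]) (simp add: word_freq_def)
qed

text \<open>
  Counts and frequencies differ by a positive factor, which does not affect angles.
\<close>

lemma angle_mult_eq_theta_ext: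
  assumes A: "finite A"
  shows "angle (words A n) (\<lambda>W. real (mult S W)) (\<lambda>W. real (mult T W)) = theta_ext A n (Inl S) (Inl T)"
proof -
  have same: "vanishes (words A n) (unit_freq A n (Inl S)) \<longleftrightarrow> vanishes (words A n) (\<lambda>W. real (mult S W))"
    and unit: "\<And>W. W \<in> words A n \<Longrightarrow>
      unit_freq A n (Inl S) W = real (mult S W) / L2_set (\<lambda>W. real (mult S W)) (words A n)" for S
  proof -
    obtain c where c: "c > 0" and f: "\<And>W. W \<in> words A n \<Longrightarrow> word_freq A n (Inl S) W = c * real (mult S W)"
      using word_freq_Inl_eq_mult[of A n S] by blast
    show "vanishes (words A n) (unit_freq A n (Inl S)) \<longleftrightarrow> vanishes (words A n) (\<lambda>W. real (mult S W))"
      unfolding vanishes_unit_freq[OF A] using c f by (simp add: vanishes_def)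
    have "L2_set (word_freq A n (Inl S)) (words A n) = L2_set (\<lambda>W. c * real (mult S W)) (words A n)"
      by (rule L2_set_cong[OF refl f])
    also have "\<dots> = c * L2_set (\<lambda>W. real (mult S W)) (words A n)"
      using c by (simp add: L2_set_right_distrib)
    finally have N: "L2_set (word_freq A n (Inl S)) (words A n) = c * L2_set (\<lambda>W. real (mult S W)) (words A n)" .
    show "unit_freq A n (Inl S) W = real (mult S W) / L2_set (\<lambda>W. real (mult S W)) (words A n)"
      if "W \<in> words A n" for W
      unfolding unit_freq_eq[OF that] N f[OF that] using c by simp
  qed
  have "dot (words A n) (unit_freq A n (Inl S)) (unit_freq A n (Inl T))
      = dot (words A n) (\<lambda>W. real (mult S W)) (\<lambda>W. real (mult T W))
        / (L2_set (\<lambda>W. real (mult S W)) (words A n) * L2_set (\<lambda>W. real (mult T W)) (words A n))"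
    by (simp add: dot_def unit sum_divide_distrib)
  then show ?thesis unfolding angle_def theta_ext_def Let_def same by simp
qed

lemma d_hat_Inl: "finite A \<Longrightarrow> d_hat A \<rho> (Inl S) (Inl T) = d_rho A \<rho> S T"
  by (simp add: d_hat_def d_rho_def angle_mult_eq_theta_ext)

lemma Metric_space_d_rho:
  assumes A: "finite A" and \<rho>: "0 < \<rho>" "\<rho> < 1"
  shows "Metric_space (lists A) (d_rho A \<rho>)"
proof -
  interpret Metric_space "ext_space A" "d_hat A \<rho>" by (rule Metric_space_d_hat[OF assms])
  have in_ext: "Inl S \<in> ext_space A" if "S \<in> lists A" for S
    unfolding ext_space_def using that by (rule InlI)
  have "d_rho A \<rho> = (\<lambda>S T. d_hat A \<rho> (Inl S) (Inl T))" by (simp add: d_hat_Inl[OF A])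
  then show ?thesis
  proof (simp only:, unfold_locales)
    fix S T assume "S \<in> lists A" "T \<in> lists A"
    then show "d_hat A \<rho> (Inl S) (Inl T) = 0 \<longleftrightarrow> S = T"
      using zero[OF in_ext in_ext] by (simp only: sum.inject)
  next
    fix S T U assume "S \<in> lists A" "T \<in> lists A" "U \<in> lists A"
    then show "d_hat A \<rho> (Inl S) (Inl U) \<le> d_hat A \<rho> (Inl S) (Inl T) + d_hat A \<rho> (Inl T) (Inl U)"
      by (intro triangle in_ext)
  qed (rule nonneg commute)+
qed

section \<open>Completeness\<close>

lemma theta_ext_tendsto_0:
  assumes A: "finite A" and nz: "\<not> vanishes (words A n) (word_freq A n Y)"
    and lim: "\<And>W. W \<in> words A n \<Longrightarrow> (\<lambda>k. word_freq A n (X k) W) \<longlonglongrightarrow> word_freq A n Y W"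
  shows "(\<lambda>k. theta_ext A n (X k) Y) \<longlonglongrightarrow> 0"
  unfolding theta_ext_eq[OF A]
proof (rule arccos_dot_tendsto_0)
  let ?N = "\<lambda>X. L2_set (word_freq A n X) (words A n)"
  have N: "(\<lambda>k. ?N (X k)) \<longlonglongrightarrow> ?N Y" unfolding L2_set_def by (intro tendsto_intros lim)
  have pos: "0 < ?N Y" by (rule L2_word_freq_pos[OF A nz])
  fix i assume i: "i \<in> padded_words A n"
  show "(\<lambda>k. padded A n (X k) i) \<longlonglongrightarrow> padded A n Y i"
  proof (cases i)
    case None
    have "\<forall>\<^sub>F k in sequentially. 0 < ?N (X k)" using order_tendstoD(1)[OF N pos] .
    then have "\<forall>\<^sub>F k in sequentially. padded A n (X k) i = padded A n Y i"
    proof eventually_elim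
      case (elim k)
      then have "\<not> vanishes (words A n) (word_freq A n (X k))"
        using L2_set_0'[of "words A n" "word_freq A n (X k)"] by (auto simp: vanishes_def)
      then show ?case using nz None by simp
    qed
    then show ?thesis by (rule tendsto_eventually)
  next
    case (Some W)
    then have W: "W \<in> words A n" using i by (auto simp: padded_words_def)
    show ?thesis
      unfolding Some padded_simps unit_freq_eq[OF W]
      using pos by (intro tendsto_divide lim W N) simp
  qed
qed (intro unit_vec_padded A)+

lemma d_hat_Inr_tendsto_0:
  assumes A: "finite A" and \<rho>: "0 < \<rho>" "\<rho> < 1" and \<mu>: "\<mu> \<in> shift_invariant_measures A"
    and lim: "\<And>W. W \<in> lists A \<Longrightarrow> W \<noteq> [] \<Longrightarrow>
      (\<lambda>k. word_freq A (length W) (X k) W) \<longlonglongrightarrow> measure \<mu> (Cyl A W)"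
  shows "(\<lambda>k. d_hat A \<rho> (X k) (Inr \<mu>)) \<longlonglongrightarrow> 0"
proof (rule d_hat_tendsto_0[OF A \<rho>])
  fix n
  show "(\<lambda>k. theta_ext A (Suc n) (X k) (Inr \<mu>)) \<longlonglongrightarrow> 0"
  proof (rule theta_ext_tendsto_0[OF A vanishes_word_freq_Inr[OF A \<mu>]])
    fix W assume "W \<in> words A (Suc n)"
    then have W: "W \<in> lists A" "length W = Suc n" by (simp_all add: words_def)
    then have "W \<noteq> []" by auto
    moreover have "word_freq A (Suc n) (Inr \<mu>) W = measure \<mu> (Cyl A W)" by (simp add: word_freq_def)
    ultimately show "(\<lambda>k. word_freq A (Suc n) (X k) W) \<longlonglongrightarrow> word_freq A (Suc n) (Inr \<mu>) W"
      using lim[OF W(1)] unfolding W(2) by simp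
  qed
qed

text \<open>
  Here \<open>s\<close> out of \<open>K\<close> windows contain an extension of a word and \<open>s + \<delta>\<close> out of \<open>K + 1\<close> windows contain the
  word itself.
\<close>

lemma window_quotient_diff:
  fixes s \<delta> K :: real
  assumes "0 \<le> \<delta>" "\<delta> \<le> 1" "0 \<le> s" "s + \<delta> \<le> K + 1" "1 \<le> K"
  shows "\<bar>s / K - (s + \<delta>) / (K + 1)\<bar> \<le> 1 / K"
proof -
  have "s / K - (s + \<delta>) / (K + 1) = (s - \<delta> * K) / (K * (K + 1))"
    using assms by (simp add: field_simps)
  moreover have "\<bar>s - \<delta> * K\<bar> \<le> K + 1"
    using assms mult_right_mono[of \<delta> 1 K] mult_nonneg_nonneg[of \<delta> K] by (intro abs_leI) linarith+
  then have "\<bar>s - \<delta> * K\<bar> / (K * (K + 1)) \<le> (K + 1) / (K * (K + 1))"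
    using assms by (intro divide_right_mono) auto
  ultimately show ?thesis using assms by (simp add: abs_divide abs_mult)
qed

text \<open>
  A measure satisfies both equations exactly.  In a string the counts differ by at most one, for the
  occurrence at an end, and the numbers of windows by one.  For a string, the vector of order
  \<open>N\<close> not vanishing means that its length is at least \<open>N\<close>.
\<close>

lemma word_freq_almost_stationary:
  assumes A: "finite A" and X: "X \<in> ext_space A" and W: "W \<in> lists A"
    and N: "length W < N" and nz: "\<not> vanishes (words A N) (word_freq A N X)"
  shows "\<bar>(\<Sum>a\<in>A. word_freq A (Suc (length W)) X (a # W)) - word_freq A (length W) X W\<bar> \<le> 1 / real (N - length W)"
    and "\<bar>(\<Sum>a\<in>A. word_freq A (Suc (length W)) X (W @ [a])) - word_freq A (length W) X W\<bar> \<le> 1 / real (N - length W)"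
proof -
  have "\<bar>(\<Sum>a\<in>A. word_freq A (Suc (length W)) X (a # W)) - word_freq A (length W) X W\<bar> \<le> 1 / real (N - length W)
     \<and> \<bar>(\<Sum>a\<in>A. word_freq A (Suc (length W)) X (W @ [a])) - word_freq A (length W) X W\<bar> \<le> 1 / real (N - length W)"
  proof (cases X)
    case (Inl S)
    then have S: "S \<in> lists A" using X by (auto simp: ext_space_def)
    have NS: "N \<le> length S" using nz vanishes_word_freq_Inl[OF A S] Inl by simp
    define K where "K = real (length S - length W)"
    have K: "K \<ge> real (N - length W)" "real (N - length W) \<ge> 1" using NS N by (simp_all add: K_def)
    have K1: "real (length S - length W + 1) = K + 1" by (simp add: K_def)
    have Suc: "length S - Suc (length W) + 1 = length S - length W" using NS N by simp
    have le: "real (mult S W) \<le> K + 1"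
      using mult_le[of S W] NS N by (simp add: K_def Suc_diff_le)
    have f: "word_freq A (length W) X W = real (mult S W) / (K + 1)"
      using NS N K1 by (simp add: Inl word_freq_def)
    have f': "(\<Sum>a\<in>A. word_freq A (Suc (length W)) X (g a)) = (\<Sum>a\<in>A. real (mult S (g a))) / K" for g
    proof -
      have "word_freq A (Suc (length W)) X (g a) = real (mult S (g a)) / K" for a
        using NS N unfolding K_def Inl word_freq_def sum.case Suc by simp
      then show ?thesis by (simp add: sum_divide_distrib)
    qed
    have bound: "\<bar>(\<Sum>a\<in>A. word_freq A (Suc (length W)) X (g a)) - word_freq A (length W) X W\<bar> \<le> 1 / real (N - length W)"
      if ex: "\<exists>\<delta>. 0 \<le> \<delta> \<and> \<delta> \<le> 1 \<and> real (mult S W) = (\<Sum>a\<in>A. real (mult S (g a))) + \<delta>" for g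
    proof -
      obtain \<delta> where \<delta>: "0 \<le> \<delta>" "\<delta> \<le> 1" "real (mult S W) = (\<Sum>a\<in>A. real (mult S (g a))) + \<delta>"
        using ex by blast
      have "\<bar>(\<Sum>a\<in>A. real (mult S (g a))) / K - ((\<Sum>a\<in>A. real (mult S (g a))) + \<delta>) / (K + 1)\<bar> \<le> 1 / K"
        using \<delta>(1,2) le[unfolded \<delta>(3)] K by (intro window_quotient_diff sum_nonneg) auto
      also have "\<dots> \<le> 1 / real (N - length W)" using K by (intro divide_left_mono) auto
      finally show ?thesis unfolding f f' \<delta>(3) .
    qed
    have "length W \<le> length S" using NS N by simp
    then show ?thesis
      using bound[OF mult_minus_sum_Cons[OF A S]] bound[OF mult_minus_sum_snoc[OF A S]] by blast
  next
    case (Inr \<mu>)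
    then have "\<mu> \<in> shift_invariant_measures A" using X by (auto simp: ext_space_def)
    from stationary_measure[OF A this] show ?thesis
      using W by (simp add: Inr word_freq_def stationary_def)
  qed
  then show "\<bar>(\<Sum>a\<in>A. word_freq A (Suc (length W)) X (a # W)) - word_freq A (length W) X W\<bar> \<le> 1 / real (N - length W)"
    and "\<bar>(\<Sum>a\<in>A. word_freq A (Suc (length W)) X (W @ [a])) - word_freq A (length W) X W\<bar> \<le> 1 / real (N - length W)"
    by blast+
qed

text \<open>
  Since every \<open>N\<close> is eventually allowed in \<open>word_freq_almost_stationary\<close>, the error there tends to
  zero.
\<close>

lemma stationary_limit:
  assumes A: "finite A" and X: "\<And>k. X k \<in> ext_space A"
    and lim: "\<And>W. W \<in> lists A \<Longrightarrow> (\<lambda>k. word_freq A (length W) (X k) W) \<longlonglongrightarrow> p W"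
    and ev: "\<And>n. 0 < n \<Longrightarrow> \<forall>\<^sub>F k in sequentially. \<not> vanishes (words A n) (word_freq A n (X k))"
  shows "stationary A p"
proof -
  have vanish: "x = 0" if le: "\<And>m. \<bar>x\<bar> \<le> 1 / real (Suc m)" for x :: real
  proof -
    have "(\<lambda>m. 1 / real (Suc m)) \<longlonglongrightarrow> 0" by (rule LIMSEQ_Suc[OF lim_1_over_n])
    then have "\<bar>x\<bar> \<le> 0" using le by (intro LIMSEQ_le_const) auto
    then show ?thesis by simp
  qed
  have eq: "(\<Sum>a\<in>A. p (g a)) = p W"
    if W: "W \<in> lists A" and g: "\<And>a. a \<in> A \<Longrightarrow> g a \<in> lists A" "\<And>a. length (g a) = Suc (length W)"
      and bound: "\<And>k N. length W < N \<Longrightarrow> \<not> vanishes (words A N) (word_freq A N (X k)) \<Longrightarrow>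
        \<bar>(\<Sum>a\<in>A. word_freq A (Suc (length W)) (X k) (g a)) - word_freq A (length W) (X k) W\<bar>
          \<le> 1 / real (N - length W)" for W g
  proof -
    have lim': "(\<lambda>k. \<bar>(\<Sum>a\<in>A. word_freq A (Suc (length W)) (X k) (g a)) - word_freq A (length W) (X k) W\<bar>)
        \<longlonglongrightarrow> \<bar>(\<Sum>a\<in>A. p (g a)) - p W\<bar>"
      using lim[OF g(1)] unfolding g(2) by (intro tendsto_intros lim[OF W]) auto
    have "\<bar>(\<Sum>a\<in>A. p (g a)) - p W\<bar> \<le> 1 / real (Suc m)" for m
    proof (rule tendsto_upperbound[OF lim'])
      have "\<forall>\<^sub>F k in sequentially.
          \<not> vanishes (words A (length W + Suc m)) (word_freq A (length W + Suc m) (X k))"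
        by (rule ev) simp
      then show "\<forall>\<^sub>F k in sequentially.
          \<bar>(\<Sum>a\<in>A. word_freq A (Suc (length W)) (X k) (g a)) - word_freq A (length W) (X k) W\<bar>
          \<le> 1 / real (Suc m)"
      proof eventually_elim
        case (elim k)
        then show ?case using bound[of "length W + Suc m" k] by simp
      qed
    qed simp
    then have "(\<Sum>a\<in>A. p (g a)) - p W = 0" by (rule vanish)
    then show ?thesis by simp
  qed
  have "p [] = 1"
  proof -
    have "(\<lambda>k. 1) \<longlonglongrightarrow> p []" using lim[of "[]"] word_freq_0[OF A X] by simp
    then show ?thesis using LIMSEQ_unique tendsto_const by blast
  qed
  moreover have "0 \<le> p W" if "W \<in> lists A" for W
    using lim[OF that] by (rule tendsto_lowerbound) (auto simp: word_freq_nonneg)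
  moreover have "(\<Sum>a\<in>A. p (W @ [a])) = p W" if W: "W \<in> lists A" for W
    using word_freq_almost_stationary(2)[OF A X W] W by (intro eq) auto
  moreover have "(\<Sum>a\<in>A. p (a # W)) = p W" if W: "W \<in> lists A" for W
    using word_freq_almost_stationary(1)[OF A X W] W by (intro eq) auto
  ultimately show ?thesis by (simp add: stationary_def)
qed

lemma eventually_not_vanishes:
  assumes "(\<lambda>k. padded A n (X k) None) \<longlonglongrightarrow> 0"
  shows "\<forall>\<^sub>F k in sequentially. \<not> vanishes (words A n) (word_freq A n (X k))"
proof -
  have "\<forall>\<^sub>F k in sequentially. padded A n (X k) None < 1"
    using order_tendstoD(2)[OF assms, of 1] by simp
  then show ?thesis by eventually_elim (simp split: if_splits)
qed

text \<open>
  Frequencies are unit coordinates divided by their sum.  The limit of these sums is nonzero because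
  the limit vector is again a unit vector, and its padding coordinate is \<open>0\<close>.
\<close>

lemma word_freq_tendsto:
  assumes A: "finite A" and X: "\<And>k. X k \<in> ext_space A"
    and lim: "\<And>i. i \<in> padded_words A n \<Longrightarrow> (\<lambda>k. padded A n (X k) i) \<longlonglongrightarrow> u i"
    and None: "u None = 0" and W: "W \<in> words A n"
  shows "(\<lambda>k. word_freq A n (X k) W) \<longlonglongrightarrow> u (Some W) / (\<Sum>V\<in>words A n. u (Some V))"
proof -
  have memb: "None \<in> padded_words A n" "\<And>V. V \<in> words A n \<Longrightarrow> Some V \<in> padded_words A n"
    by (auto simp: padded_words_def)
  have ev: "\<forall>\<^sub>F k in sequentially. \<not> vanishes (words A n) (word_freq A n (X k))"
    using lim[OF memb(1)] unfolding None by (rule eventually_not_vanishes)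
  have U: "(\<lambda>k. unit_freq A n (X k) V) \<longlonglongrightarrow> u (Some V)" if "V \<in> words A n" for V
    using lim[OF memb(2)[OF that]] by simp
  have "(\<lambda>k. dot (padded_words A n) (padded A n (X k)) (padded A n (X k))) \<longlonglongrightarrow> dot (padded_words A n) u u"
    unfolding dot_def by (intro tendsto_intros lim)
  moreover have "dot (padded_words A n) (padded A n (X k)) (padded A n (X k)) = 1" for k
    using unit_vec_padded[OF A, of n "X k"] by (simp add: unit_vec_def)
  ultimately have "dot (padded_words A n) u u = 1" by (simp add: LIMSEQ_const_iff)
  then have sq: "(\<Sum>V\<in>words A n. u (Some V) * u (Some V)) = 1"
    using None by (simp add: dot_def sum_padded_words[OF A])
  have nonneg: "0 \<le> u (Some V)" if "V \<in> words A n" for V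
    using U[OF that] by (rule tendsto_lowerbound) (auto simp: unit_freq_nonneg)
  have nz: "(\<Sum>V\<in>words A n. u (Some V)) \<noteq> 0"
  proof
    assume "(\<Sum>V\<in>words A n. u (Some V)) = 0"
    then have "\<forall>V\<in>words A n. u (Some V) = 0"
      using vanishes_iff_sum_0[of "words A n" "\<lambda>V. u (Some V)"] finite_words[OF A] nonneg
      unfolding vanishes_def by blast
    then have "(\<Sum>V\<in>words A n. u (Some V) * u (Some V)) = 0" by (intro sum.neutral ballI) simp
    then show False using sq by simp
  qed
  have "(\<lambda>k. unit_freq A n (X k) W / (\<Sum>V\<in>words A n. unit_freq A n (X k) V))
      \<longlonglongrightarrow> u (Some W) / (\<Sum>V\<in>words A n. u (Some V))"
    by (intro tendsto_divide U W tendsto_sum nz)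
  then show ?thesis
  proof (rule Lim_transform_eventually)
    show "\<forall>\<^sub>F k in sequentially. unit_freq A n (X k) W / (\<Sum>V\<in>words A n. unit_freq A n (X k) V) = word_freq A n (X k) W"
      using ev by eventually_elim (simp add: word_freq_eq_unit_freq[OF A X])
  qed
qed

text \<open>
  Some value is attained infinitely often, and a Cauchy sequence converges to it.
\<close>

lemma (in Metric_space) MCauchy_in_finite_set_converges:
  assumes \<sigma>: "MCauchy \<sigma>" and F: "finite F" and ev: "\<forall>\<^sub>F k in sequentially. \<sigma> k \<in> F"
  shows "\<exists>x. limitin mtopology \<sigma> x sequentially"
proof -
  obtain k0 where k0: "\<And>k. k \<ge> k0 \<Longrightarrow> \<sigma> k \<in> F" using ev by (auto simp: eventually_sequentially)
  have "infinite {k0..}" by (rule infinite_Ici)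
  moreover have "finite (\<sigma> ` {k0..})" by (rule finite_subset[OF _ F]) (use k0 in auto)
  ultimately obtain m where m: "infinite {k \<in> {k0..}. \<sigma> k = \<sigma> m}"
    using pigeonhole_infinite[of "{k0..}" \<sigma>] by blast
  have M: "\<sigma> k \<in> M" for k using \<sigma> by (auto simp: MCauchy_def)
  have "limitin mtopology \<sigma> (\<sigma> m) sequentially"
    unfolding limit_metric_sequentially
  proof (intro conjI allI impI M)
    fix \<epsilon> :: real assume "\<epsilon> > 0"
    then obtain N where N: "\<And>n n'. N \<le> n \<Longrightarrow> N \<le> n' \<Longrightarrow> d (\<sigma> n) (\<sigma> n') < \<epsilon>"
      using \<sigma> unfolding MCauchy_def by blast
    obtain l where "l \<ge> N" "\<sigma> l = \<sigma> m"
      using m unfolding infinite_nat_iff_unbounded_le by blast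
    then have "d (\<sigma> n) (\<sigma> m) < \<epsilon>" if "n \<ge> N" for n using N[OF that, of l] by simp
    then show "\<exists>N. \<forall>n\<ge>N. \<sigma> n \<in> M \<and> d (\<sigma> n) (\<sigma> m) < \<epsilon>" using M by blast
  qed
  then show ?thesis by blast
qed

theorem mcomplete_d_hat:
  assumes A: "finite A" and \<rho>: "0 < \<rho>" "\<rho> < 1"
  shows "Metric_space.mcomplete (ext_space A) (d_hat A \<rho>)"
proof -
  interpret Metric_space "ext_space A" "d_hat A \<rho>" by (rule Metric_space_d_hat[OF assms])
  show ?thesis
    unfolding mcomplete_def
  proof (intro allI impI)
    fix \<sigma> assume \<sigma>: "MCauchy \<sigma>"
    have X: "\<sigma> k \<in> ext_space A" for k using \<sigma> by (auto simp: MCauchy_def)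
    have conv: "convergent (\<lambda>k. padded A n (\<sigma> k) i)" if n: "n > 0" and i: "i \<in> padded_words A n" for n i
    proof (rule Cauchy_convergent, rule metric_CauchyI)
      fix \<epsilon> :: real assume "\<epsilon> > 0"
      obtain m where m: "n = Suc m" using n by (cases n) auto
      have pos: "\<rho> ^ n > 0" using \<rho> by simp
      then have "\<epsilon> * \<rho> ^ n > 0" using \<open>\<epsilon> > 0\<close> by simp
      then obtain N where N: "\<And>k l. N \<le> k \<Longrightarrow> N \<le> l \<Longrightarrow> d_hat A \<rho> (\<sigma> k) (\<sigma> l) < \<epsilon> * \<rho> ^ n"
        using \<sigma> unfolding MCauchy_def by blast
      show "\<exists>N. \<forall>k\<ge>N. \<forall>l\<ge>N. dist (padded A n (\<sigma> k) i) (padded A n (\<sigma> l) i) < \<epsilon>"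
      proof (intro exI[of _ N] allI impI)
        fix k l assume kl: "k \<ge> N" "l \<ge> N"
        have "\<rho> ^ n * theta_ext A n (\<sigma> k) (\<sigma> l) < \<rho> ^ n * \<epsilon>"
          using theta_ext_le_d_hat[OF assms, of m "\<sigma> k" "\<sigma> l"] N[OF kl] unfolding m by (simp only: mult.commute)
        then have "theta_ext A n (\<sigma> k) (\<sigma> l) < \<epsilon>" using pos by (simp only: mult_less_cancel_left_pos)
        then show "dist (padded A n (\<sigma> k) i) (padded A n (\<sigma> l) i) < \<epsilon>"
          using padded_diff_le[OF A i, of "\<sigma> k" "\<sigma> l"] by (simp only: dist_real_def)
      qed
    qed
    define u where "u n i = lim (\<lambda>k. padded A n (\<sigma> k) i)" for n i
    have u: "(\<lambda>k. padded A n (\<sigma> k) i) \<longlonglongrightarrow> u n i" if "n > 0" "i \<in> padded_words A n" for n i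
      unfolding u_def using conv[OF that] by (simp only: convergent_LIMSEQ_iff)
    have None: "None \<in> padded_words A n" for n by (simp add: padded_words_def)
    show "\<exists>X. limitin mtopology \<sigma> X sequentially"
    proof (cases "\<exists>n>0. u n None \<noteq> 0")
      case True
      then obtain n where n: "n > 0" "u n None \<noteq> 0" by blast
      \<comment> \<open>The padding coordinate takes only the values \<open>0\<close> and \<open>1\<close>, so eventually it is \<open>1\<close>.\<close>
      define F :: "'a ext set" where "F = Inl ` {S. set S \<subseteq> A \<and> length S \<le> n}"
      have "finite F" unfolding F_def by (intro finite_imageI finite_lists_length_le A)
      moreover have "\<forall>\<^sub>F k in sequentially. padded A n (\<sigma> k) None \<noteq> 0"
        using tendsto_imp_eventually_ne[OF u[OF n(1) None] n(2)] .
      then have "\<forall>\<^sub>F k in sequentially. \<sigma> k \<in> F"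
      proof eventually_elim
        case (elim k)
        then have v: "vanishes (words A n) (word_freq A n (\<sigma> k))" by (simp split: if_splits)
        show ?case
        proof (cases "\<sigma> k")
          case (Inl S)
          then have S: "S \<in> lists A" using X[of k] by (auto simp: ext_space_def)
          then have "length S < n" using v vanishes_word_freq_Inl[OF A S] Inl by simp
          then show ?thesis using S Inl by (auto simp: F_def)
        next
          case (Inr \<mu>)
          then have "\<mu> \<in> shift_invariant_measures A" using X[of k] by (auto simp: ext_space_def)
          then show ?thesis using v vanishes_word_freq_Inr[OF A] Inr by simp
        qed
      qed
      ultimately show ?thesis by (rule MCauchy_in_finite_set_converges[OF \<sigma>])
    next
      case False
      then have u0: "u n None = 0" if "n > 0" for n using that by blast
      define p where "p W = (if W = [] then 1 else u (length W) (Some W) / (\<Sum>V\<in>words A (length W). u (length W) (Some V)))" for W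
      have lim: "(\<lambda>k. word_freq A (length W) (\<sigma> k) W) \<longlonglongrightarrow> p W" if W: "W \<in> lists A" for W
      proof (cases "W = []")
        case True
        then show ?thesis using word_freq_0[OF A X] by (simp add: p_def)
      next
        case False
        then have n: "length W > 0" by simp
        have "W \<in> words A (length W)" using W by (simp add: words_def)
        from word_freq_tendsto[where u = "u (length W)", OF A X u[OF n] u0[OF n] this]
        show ?thesis using False by (simp add: p_def)
      qed
      have "\<forall>\<^sub>F k in sequentially. \<not> vanishes (words A n) (word_freq A n (\<sigma> k))" if n: "n > 0" for n
        using u[OF n None] unfolding u0[OF n] by (rule eventually_not_vanishes)
      then have "stationary A p" by (intro stationary_limit[OF A X lim])
      then obtain \<mu> where \<mu>: "\<mu> \<in> shift_invariant_measures A" "\<And>W. W \<in> lists A \<Longrightarrow> measure \<mu> (Cyl A W) = p W"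
        using ex_measure_of_stationary[OF A] by blast
      have "(\<lambda>k. d_hat A \<rho> (\<sigma> k) (Inr \<mu>)) \<longlonglongrightarrow> 0"
        using lim \<mu>(2) by (intro d_hat_Inr_tendsto_0[OF A \<rho> \<mu>(1)]) simp
      moreover have "Inr \<mu> \<in> ext_space A" unfolding ext_space_def using \<mu>(1) by (rule InrI)
      ultimately have "limitin mtopology \<sigma> (Inr \<mu>) sequentially"
        using X by (simp add: limitin_metric_dist_null)
      then show ?thesis by blast
    qed
  qed
qed

section \<open>Density of the strings\<close>

text \<open>
  Repeat each word \<open>V\<close> of length \<open>L\<close> about \<open>K * p V\<close> times, with \<open>K\<close> so large that rounding up to
  integers is harmless, and concatenate these \<open>M\<close> blocks.  Rounding, the occurrences of \<open>W\<close> across block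
  borders and the replacement of the number of windows by the length each change the frequency by
  \<open>O(length W / L)\<close>.
\<close>

lemma approximating_string:
  assumes A: "finite A" and p: "stationary A p" and L: "0 < L"
  shows "\<exists>S\<in>lists A. \<forall>W\<in>lists A. 0 < length W \<longrightarrow> length W \<le> L \<longrightarrow>
    \<bar>word_freq A (length W) (Inl S) W - p W\<bar> \<le> 3 * real (length W) / real L"
proof -
  define I where "I = words A L"
  have finI: "finite I" unfolding I_def by (rule finite_words[OF A])
  have sum_p: "(\<Sum>V\<in>I. p V) = 1" unfolding I_def by (rule sum_stationary_words[OF p])
  then have "I \<noteq> {}" by auto
  then have cI: "1 \<le> card I" using finI by (simp add: Suc_le_eq card_gt_0_iff)
  have p_nonneg: "0 \<le> p V" if "V \<in> lists A" for V using p that by (simp add: stationary_def)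
  have pI: "0 \<le> p V" if "V \<in> I" for V using that by (intro p_nonneg) (simp add: I_def words_def)
  \<comment> \<open>Rounding costs at most \<open>card I\<close> in total; relative to \<open>K\<close> this is \<open>1 / L\<close>.\<close>
  define K where "K = L * card I"
  have K: "1 \<le> K" using L cI by (simp add: K_def)
  define m where "m V = nat \<lceil>real K * p V\<rceil>" for V
  have m: "real K * p V \<le> real (m V)" "real (m V) \<le> real K * p V + 1" if "V \<in> I" for V
    using pI[OF that] unfolding m_def by (simp_all add: of_nat_ceiling)
  define M where "M = (\<Sum>V\<in>I. m V)"
  have M_real: "real M = (\<Sum>V\<in>I. real (m V))" by (simp add: M_def)
  have KM: "real K \<le> real M"
  proof -
    have "real K = (\<Sum>V\<in>I. real K * p V)" using sum_p by (simp flip: sum_distrib_left)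
    also have "\<dots> \<le> real M" unfolding M_real using m by (intro sum_mono) simp
    finally show ?thesis .
  qed
  have MK: "real M \<le> real K + real (card I)"
  proof -
    have "real M \<le> (\<Sum>V\<in>I. real K * p V + 1)" unfolding M_real using m by (intro sum_mono) simp
    also have "\<dots> = real K + real (card I)" using sum_p by (simp add: sum.distrib flip: sum_distrib_left)
    finally show ?thesis .
  qed
  have M1: "1 \<le> M" using K KM by simp
  \<comment> \<open>Rounding and passing from \<open>K\<close> to \<open>M\<close> each cost at most \<open>card I\<close> in the sum.\<close>
  have close: "(\<Sum>V\<in>I. \<bar>real (m V) - real M * p V\<bar>) \<le> 2 * real (card I)"
  proof -
    have "(\<Sum>V\<in>I. \<bar>real (m V) - real M * p V\<bar>) \<le> (\<Sum>V\<in>I. 1 + (real M - real K) * p V)"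
    proof (intro sum_mono)
      fix V assume V: "V \<in> I"
      have "\<bar>real (m V) - real M * p V\<bar> \<le> \<bar>real (m V) - real K * p V\<bar> + \<bar>(real M - real K) * p V\<bar>"
        unfolding left_diff_distrib by linarith
      also have "\<bar>(real M - real K) * p V\<bar> = (real M - real K) * p V"
        using KM pI[OF V] by (intro abs_of_nonneg mult_nonneg_nonneg) auto
      also have "\<bar>real (m V) - real K * p V\<bar> \<le> 1" using m[OF V] by linarith
      finally show "\<bar>real (m V) - real M * p V\<bar> \<le> 1 + (real M - real K) * p V" by simp
    qed
    also have "\<dots> = real (card I) + (real M - real K)"
      using sum_p by (simp add: sum.distrib flip: sum_distrib_left)
    finally show ?thesis using MK by linarith
  qed
  obtain Vs where Vs: "set Vs \<subseteq> I" and sumVs: "\<And>f :: 'a list \<Rightarrow> nat. (\<Sum>V\<leftarrow>Vs. f V) = (\<Sum>V\<in>I. m V * f V)"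
    using list_with_multiplicities[OF finI, of m] by blast
  have lenVs: "length Vs = M" using sumVs[of "\<lambda>_. 1"] by (simp add: M_def sum_list_triv)
  define S where "S = concat Vs"
  have "V \<in> lists A" if "V \<in> set Vs" for V using Vs that unfolding I_def words_def by blast
  then have S: "S \<in> lists A" by (simp add: S_def in_lists_conv_set)
  have "(\<Sum>V\<in>I. m V * length V) = (\<Sum>V\<in>I. m V * L)"
    by (intro sum.cong refl) (simp add: I_def words_def)
  then have lenS: "length S = L * M"
    using sumVs[of length] by (simp add: S_def length_concat M_def sum_distrib_left mult.commute)
  have "\<bar>word_freq A (length W) (Inl S) W - p W\<bar> \<le> 3 * real (length W) / real L"
    if W: "W \<in> lists A" and n: "0 < length W" "length W \<le> L" for W
  proof -
    define n where "n = real (length W)"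
    define c where "c = real (mult S W)"
    define T where "T = (\<Sum>V\<in>I. real (m V) * real (mult V W))"
    have n1: "1 \<le> n" "n \<le> real L" using \<open>0 < length W\<close> \<open>length W \<le> L\<close> by (simp_all add: n_def Suc_le_eq)
    have "W \<noteq> []" using \<open>0 < length W\<close> by auto
    note blocks = mult_concat[OF this, of Vs]
    have Tnat: "T = real (\<Sum>V\<leftarrow>Vs. mult V W)" unfolding sumVs T_def by simp
    have cT: "T \<le> c" "c \<le> T + n * real M"
      using blocks unfolding c_def Tnat S_def lenVs n_def by (simp_all flip: of_nat_mult of_nat_add)
    have ST: "(\<Sum>V\<in>I. p V * real (mult V W)) = (real L + 1 - n) * p W"
      using sum_stationary_mult[OF p W A, of L] \<open>length W \<le> L\<close>
      by (simp add: I_def n_def of_nat_diff)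
    have "\<bar>T - real M * ((real L + 1 - n) * p W)\<bar> = \<bar>\<Sum>V\<in>I. (real (m V) - real M * p V) * real (mult V W)\<bar>"
      unfolding ST[symmetric] T_def by (simp add: left_diff_distrib sum_subtractf sum_distrib_left mult.assoc)
    also have "\<dots> \<le> (\<Sum>V\<in>I. \<bar>real (m V) - real M * p V\<bar> * real L)"
    proof (rule order_trans[OF sum_abs], rule sum_mono)
      fix V assume "V \<in> I"
      then have "length V = L" by (simp add: I_def words_def)
      then have "mult V W \<le> L" using mult_le[of V W] \<open>0 < length W\<close> by linarith
      then show "\<bar>(real (m V) - real M * p V) * real (mult V W)\<bar> \<le> \<bar>real (m V) - real M * p V\<bar> * real L"
        unfolding abs_mult by (intro mult_left_mono) auto
    qed
    also have "\<dots> \<le> 2 * real (card I) * real L"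
      using close by (simp add: mult_right_mono flip: sum_distrib_right)
    also have "\<dots> \<le> 2 * real M" using KM by (simp add: K_def mult.commute)
    finally have T: "\<bar>T - real M * ((real L + 1 - n) * p W)\<bar> \<le> 2 * real M" .
    have pW: "0 \<le> p W" "p W \<le> 1"
    proof -
      show "0 \<le> p W" by (rule p_nonneg[OF W])
      have "p W \<le> (\<Sum>V\<in>words A (length W). p V)"
        using W p_nonneg by (intro member_le_sum finite_words A) (auto simp: words_def)
      then show "p W \<le> 1" using sum_stationary_words[OF p] by simp
    qed
    define l where "l = real L * real M"
    have l: "l = real (length S)" by (simp add: l_def lenS)
    have Ml: "real M * n \<le> l" "real M > 0" using n1 M1 by (simp_all add: l_def mult.commute)
    have "1 * n \<le> real M * n" using M1 n1 by (intro mult_right_mono) simp_all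
    then have "n \<le> l" using Ml by linarith
    then have nS: "length W \<le> length S" unfolding l n_def by simp
    have "c \<le> l - n + 1"
      using mult_le[of S W] nS unfolding c_def l n_def by (simp add: Suc_diff_le)
    have c0: "0 \<le> c" by (simp add: c_def)
    have freq: "word_freq A (length W) (Inl S) W = c / (l - n + 1)"
      using nS by (simp add: word_freq_def c_def l n_def of_nat_diff)
    have D: "0 < l - n + 1" using \<open>n \<le> l\<close> by simp
    have l0: "0 < l" using n1 \<open>n \<le> l\<close> by linarith
    have bd: "\<bar>c - l * p W\<bar> \<le> (2 * n + 1) * real M"
    proof -
      define b where "b = real M * ((n - 1) * p W)"
      have eq: "real M * ((real L + 1 - n) * p W) = l * p W - b"
        by (simp add: l_def b_def algebra_simps)
      have "0 \<le> b" unfolding b_def using n1 pW by simp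
      moreover have "b \<le> real M * (n - 1)"
        unfolding b_def using n1 pW by (intro mult_left_mono mult_left_le) simp_all
      ultimately have "\<bar>c - l * p W\<bar> \<le> 2 * real M + n * real M + real M * (n - 1)"
        using T cT unfolding eq by linarith
      also have "\<dots> = (2 * n + 1) * real M" by (simp add: algebra_simps)
      finally show ?thesis .
    qed
    have "\<bar>c / l - p W\<bar> \<le> (2 * n + 1) * real M / l"
    proof -
      have "\<bar>c / l - p W\<bar> = \<bar>(c - l * p W) / l\<bar>" using l0 by (simp add: diff_divide_distrib)
      then show ?thesis using bd l0 by (simp add: abs_divide divide_right_mono)
    qed
    also have "\<dots> = (2 * n + 1) / real L" using Ml by (simp add: l_def)
    finally have 1: "\<bar>c / l - p W\<bar> \<le> (2 * n + 1) / real L" .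
    have "c / (l - n + 1) - c / l = (c / (l - n + 1)) * ((n - 1) / l)"
      using D l0 by (simp add: field_simps)
    also have "\<bar>\<dots>\<bar> \<le> 1 * ((n - 1) / real L)"
    proof -
      have "c / (l - n + 1) \<le> 1" "0 \<le> c / (l - n + 1)" using D c0 \<open>c \<le> l - n + 1\<close> by auto
      moreover have "(n - 1) / l \<le> (n - 1) / real L" "0 \<le> (n - 1) / l"
        using n1 M1 l0 L by (auto simp: l_def intro!: divide_left_mono)
      ultimately show ?thesis unfolding abs_mult by (intro mult_mono) (simp_all only: abs_of_nonneg abs_ge_zero zero_le_one)
    qed
    finally have 2: "\<bar>c / (l - n + 1) - c / l\<bar> \<le> (n - 1) / real L" by simp
    have "\<bar>c / (l - n + 1) - p W\<bar> \<le> (2 * n + 1) / real L + (n - 1) / real L"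
      using 1 2 by linarith
    also have "\<dots> = 3 * n / real L" by (simp flip: add_divide_distrib)
    finally show ?thesis unfolding freq n_def .
  qed
  then show ?thesis using S by blast
qed

text \<open>
  Approximating strings for \<open>L = k + 1\<close> have frequencies that converge to those of the measure, for all
  words simultaneously.
\<close>

theorem strings_dense:
  assumes A: "finite A" and \<rho>: "0 < \<rho>" "\<rho> < 1"
  shows "Metric_space.mtopology (ext_space A) (d_hat A \<rho>) closure_of (Inl ` lists A) = ext_space A"
proof -
  interpret Metric_space "ext_space A" "d_hat A \<rho>" by (rule Metric_space_d_hat[OF assms])
  have Inl: "Inl S \<in> ext_space A" if "S \<in> lists A" for S
    unfolding ext_space_def using that by (rule InlI)
  have "\<exists>S\<in>lists A. d_hat A \<rho> X (Inl S) < r" if X: "X \<in> ext_space A" and r: "r > 0" for X r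
  proof (cases X)
    case (Inl S)
    then have "S \<in> lists A" using X by (auto simp: ext_space_def)
    moreover have "d_hat A \<rho> X (Inl S) < r" using d_hat_self[OF assms, of X] Inl r by simp
    ultimately show ?thesis by blast
  next
    case (Inr \<mu>)
    then have \<mu>: "\<mu> \<in> shift_invariant_measures A" using X by (auto simp: ext_space_def)
    have "\<forall>k. \<exists>S. S \<in> lists A \<and> (\<forall>W\<in>lists A. 0 < length W \<longrightarrow> length W \<le> Suc k \<longrightarrow>
        \<bar>word_freq A (length W) (Inl S) W - measure \<mu> (Cyl A W)\<bar> \<le> 3 * real (length W) / real (Suc k))"
      using approximating_string[OF A stationary_measure[OF A \<mu>] zero_less_Suc] unfolding Bex_def by blast
    from choice[OF this] obtain S where S: "\<And>k. S k \<in> lists A"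
      and close: "\<And>k W. W \<in> lists A \<Longrightarrow> 0 < length W \<Longrightarrow> length W \<le> Suc k \<Longrightarrow>
        \<bar>word_freq A (length W) (Inl (S k)) W - measure \<mu> (Cyl A W)\<bar> \<le> 3 * real (length W) / real (Suc k)"
      by blast
    have "(\<lambda>k. d_hat A \<rho> (Inl (S k)) (Inr \<mu>)) \<longlonglongrightarrow> 0"
    proof (rule d_hat_Inr_tendsto_0[OF A \<rho> \<mu>])
      fix W assume W: "W \<in> lists A" "W \<noteq> []"
      have "(\<lambda>k. word_freq A (length W) (Inl (S k)) W - measure \<mu> (Cyl A W)) \<longlonglongrightarrow> 0"
      proof (rule Lim_null_comparison)
        show "\<forall>\<^sub>F k in sequentially. norm (word_freq A (length W) (Inl (S k)) W - measure \<mu> (Cyl A W))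
            \<le> 3 * real (length W) / real (Suc k)"
          using W by (intro eventually_sequentiallyI[of "length W"]) (simp only: real_norm_def, rule close, auto)
        show "(\<lambda>k. 3 * real (length W) / real (Suc k)) \<longlonglongrightarrow> 0"
          by (rule LIMSEQ_Suc[OF lim_const_over_n])
      qed
      then show "(\<lambda>k. word_freq A (length W) (Inl (S k)) W) \<longlonglongrightarrow> measure \<mu> (Cyl A W)"
        by (simp only: LIM_zero_iff)
    qed
    then have "\<forall>\<^sub>F k in sequentially. d_hat A \<rho> (Inl (S k)) (Inr \<mu>) < r"
      using r by (rule order_tendstoD(2))
    then obtain k where "d_hat A \<rho> (Inl (S k)) (Inr \<mu>) < r"
      using eventually_happens by fastforce
    then show ?thesis using S commute unfolding Inr by metis
  qed
  then show ?thesis unfolding metric_closure_of using Inl by (auto simp: mball_def)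
qed

section \<open>The completion of the space of strings\<close>

theorem is_completion_ext_space:
  assumes A: "finite A" and \<rho>: "0 < \<rho>" "\<rho> < 1"
  shows "is_completion (lists A) (d_rho A \<rho>) (ext_space A) (d_hat A \<rho>) Inl"
  unfolding is_completion_def
proof (intro conjI ballI)
  show "Inl \<in> lists A \<rightarrow> ext_space A" unfolding ext_space_def by (intro Pi_I InlI)
qed (intro Metric_space_d_rho Metric_space_d_hat mcomplete_d_hat strings_dense d_hat_Inl assms | assumption)+

theorem theorem7p18:
  fixes A :: "'a set" and \<rho> :: real
  assumes "finite A" and "0 < \<rho>" and "\<rho> < 1"
  shows "Metric_space (ext_space A) (d_hat A \<rho>)
    \<and> (\<forall>S\<in>lists A. \<forall>T\<in>lists A. d_hat A \<rho> (Inl S) (Inl T) = d_rho A \<rho> S T)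
    \<and> Metric_space.mcomplete (ext_space A) (d_hat A \<rho>)
    \<and> Metric_space.mtopology (ext_space A) (d_hat A \<rho>) closure_of (Inl ` lists A) = ext_space A
    \<and> is_completion (lists A) (d_rho A \<rho>) (ext_space A) (d_hat A \<rho>) Inl
    \<and> (\<forall>(N :: 'c set) e j. is_completion (lists A) (d_rho A \<rho>) N e j \<longrightarrow>
         (\<exists>!\<phi>. \<phi> \<in> N \<rightarrow>\<^sub>E ext_space A \<and> \<phi> ` N = ext_space A
            \<and> (\<forall>x\<in>N. \<forall>y\<in>N. d_hat A \<rho> (\<phi> x) (\<phi> y) = e x y)
            \<and> (\<forall>S\<in>lists A. \<phi> (j S) = Inl S)))"
proof (intro conjI ballI allI impI)
  fix N :: "'c set" and e j
  assume "is_completion (lists A) (d_rho A \<rho>) N e j"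
  then show "\<exists>!\<phi>. \<phi> \<in> N \<rightarrow>\<^sub>E ext_space A \<and> \<phi> ` N = ext_space A
      \<and> (\<forall>x\<in>N. \<forall>y\<in>N. d_hat A \<rho> (\<phi> x) (\<phi> y) = e x y) \<and> (\<forall>S\<in>lists A. \<phi> (j S) = Inl S)"
    by (rule completion_unique[OF _ is_completion_ext_space[OF assms]])
qed (intro Metric_space_d_hat mcomplete_d_hat strings_dense d_hat_Inl is_completion_ext_space assms | assumption)+

end
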